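(* Let $\Sigma$ be a finite set, $n\ge 1$, $\mathbb{X}\subseteq\Sigma^n$, and let $\rho,\sigma$ be $|\mathbb{X}|\times|\mathbb{X}|$ Gram matrices of unit vectors (indexed by $\mathbb{X}$). Then, for any choice of the oracle family $\{h(y)\}_{y\in\Sigma}$ (Hermitian, $\|h(y)\|\le 1$), $$Q_0^{\mathrm{ct}}(\rho,\sigma)\;\ge\;\tfrac12\,\mathrm{Adv}^\star(\rho,\sigma),$$ and for every $\varepsilon\in[0,1)$, $$Q_\varepsilon^{\mathrm{ct}}(\rho,\sigma)\;\ge\;\tfrac12\,\min_{\sigma'}\Big\{\mathrm{Adv}^\star(\rho,\sigma')\;:\;\sigma' \text{ an } |\mathbb{X}|\times|\mathbb{X}| \text{ Gram matrix of unit vectors with } \mathcal{F}_H(\sigma,\sigma')\ge\sqrt{1-\varepsilon}\Big\}.$$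
   Context: Notation: for matrices $A,B$, $\langle A,B\rangle=\mathrm{tr}(A^*B)$, $(A\circ B)_{ij}=A_{ij}B_{ij}$ (Hadamard product), $\|A\|$ is the operator norm, $\|A\|_{\mathrm{tr}}$ the trace norm. Adversary bound: for $j\in[n]$ let $\Delta_j$ be the $|\mathbb{X}|\times|\mathbb{X}|$ matrix with $(\Delta_j)_{x,y}=1-\delta_{x_j,y_j}$. For $|\mathbb{X}|\times|\mathbb{X}|$ matrices $\rho,\sigma$, $\mathrm{Adv}^\star(\rho,\sigma)=\max_{\Gamma}\|\Gamma\circ(\rho-\sigma)\|$ over Hermitian $|\mathbb{X}|\times|\mathbb{X}|$ matrices $\Gamma$ with $\|\Gamma\circ\Delta_j\|\le 1$ for all $j\in[n]$. Hadamard product fidelity: for Gram matrices $\rho,\sigma$ of unit vectors, $\mathcal{F}_H(\rho,\sigma)=\min_{u:\|u\|=1}\mathcal{F}(\rho\circ uu^*,\sigma\circ uu^* )$, where $\mathcal{F}(\rho',\sigma')=\mathrm{tr}\sqrt{\sqrt{\rho'}\sigma'\sqrt{\rho'}}$ is the fidelity of density matrices. Continuous-time query model: fix Hermitian operators $h(y)$, $y\in\Sigma$, on $\mathbb{C}^r$ with $\|h(y)\|\le1$; the oracle Hamiltonian for input $x\in\mathbb{X}$ is $H_{\mathcal Q}(x)=\sum_{j=1}^n |j\rangle\langle j|\otimes h(x_j)$ on $\mathbb{C}^n\otimes\mathbb{C}^r$. An algorithm of duration $T$ acts on a finite-dimensional Hilbert space $\mathcal{H}=(\mathbb{C}^n\otimes\mathbb{C}^r\otimes\mathbb{C}^w)\oplus\mathcal{H}'$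 via the Hamiltonian $H_x(t)=H_{\mathcal D}(t)+\alpha(t)\,\widetilde H_{\mathcal Q}(x)$, $t\in[0,T]$, where $\widetilde H_{\mathcal Q}(x)$ acts as $H_{\mathcal Q}(x)\otimes I$ on the first summand and as $0$ on $\mathcal H'$, $H_{\mathcal D}(t)$ is an input-independent Hermitian operator (piecewise continuous in $t$), and $\alpha:[0,T]\to\mathbb{R}$ satisfies $|\alpha(t)|\le1$. Let $\mathcal U_x$ be the unitary generated at time $T$ (solution of $i\,\tfrac{d}{dt}U(t)=H_x(t)U(t)$, $U(0)=I$). Choosing unit vectors $|\rho_x\rangle,|\sigma_x\rangle$ with Gram matrices $\rho,\sigma$ and a fixed workspace state $|0\rangle$, the algorithm converts $\rho$ to $\sigma$ with error at most $\varepsilon$ if $\mathrm{Re}\,\langle\sigma_x,0|\mathcal U_x|\rho_x,0\rangle\ge\sqrt{1-\varepsilon}$ for all $x\in\mathbb{X}$. $Q^{\mathrm{ct}}_\varepsilon(\rho,\sigma)$ is the infimum of $T$ over algorithms converting $\rho$ to $\sigma$ with error at most $\varepsilon$; $Q^{\mathrm{ct}}_0$ is the exact case $\varepsilon=0$. *)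

theory Defs
  imports "HOL-Analysis.Analysis" "Jordan_Normal_Form.Matrix"
begin

type_synonym cvec = "complex Matrix.vec"

definition cinner :: "cvec \<Rightarrow> cvec \<Rightarrow> complex" where
  "cinner u v = (\<Sum>i<dim_vec u. cnj (u $ i) * v $ i)"

definition cnorm :: "cvec \<Rightarrow> real" where
  "cnorm v = sqrt (\<Sum>i<dim_vec v. (cmod (v $ i))^2)"

definition unit_vecs :: "nat \<Rightarrow> cvec set" where
  "unit_vecs k = {v. dim_vec v = k \<and> cnorm v = 1}"

text \<open>Operator norm (0 for matrices with no columns).\<close>
definition opnorm :: "complex mat \<Rightarrow> real" where
  "opnorm A = Sup (insert 0 {cnorm (A *\<^sub>v v) | v. v \<in> unit_vecs (dim_col A)})"

definition adj :: "complex mat \<Rightarrow> complex mat" where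
  "adj A = mat (dim_col A) (dim_row A) (\<lambda>(i,j). cnj (A $$ (j,i)))"

definition hermitian :: "complex mat \<Rightarrow> bool" where
  "hermitian A \<longleftrightarrow> square_mat A \<and> adj A = A"

definition psd :: "complex mat \<Rightarrow> bool" where
  "psd A \<longleftrightarrow> hermitian A \<and> (\<forall>v. dim_vec v = dim_row A \<longrightarrow> 0 \<le> Re (cinner v (A *\<^sub>v v)))"

definition psd_sqrt :: "complex mat \<Rightarrow> complex mat" where
  "psd_sqrt A = (THE B. psd B \<and> B * B = A)"

definition mtrace :: "complex mat \<Rightarrow> complex" where
  "mtrace A = (\<Sum>i<dim_row A. A $$ (i,i))"

definition fidelity :: "complex mat \<Rightarrow> complex mat \<Rightarrow> real" where
  "fidelity R S = Re (mtrace (psd_sqrt (psd_sqrt R * S * psd_sqrt R)))"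

definition hadamard :: "complex mat \<Rightarrow> complex mat \<Rightarrow> complex mat" where
  "hadamard A B = mat (dim_row A) (dim_col A) (\<lambda>(i,j). A $$ (i,j) * B $$ (i,j))"

definition outer :: "cvec \<Rightarrow> complex mat" where
  "outer u = mat (dim_vec u) (dim_vec u) (\<lambda>(i,j). u $ i * cnj (u $ j))"

definition gram_unit :: "nat \<Rightarrow> complex mat \<Rightarrow> bool" where
  "gram_unit m R \<longleftrightarrow> (\<exists>d vs. (\<forall>k<m. vs k \<in> unit_vecs d) \<and>
      R = mat m m (\<lambda>(k,l). cinner (vs k) (vs l)))"

definition fid_H :: "complex mat \<Rightarrow> complex mat \<Rightarrow> ereal" where
  "fid_H R S = (INF u \<in> unit_vecs (dim_row R).
      ereal (fidelity (hadamard R (outer u)) (hadamard S (outer u))))"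

text \<open>Inputs are enumerated by the distinct list X (entries indexed 0..length X - 1);
  coordinate j of input x is x ! j, j < n.\<close>
definition Delta :: "'a list list \<Rightarrow> nat \<Rightarrow> complex mat" where
  "Delta X j = mat (length X) (length X) (\<lambda>(a,b). if X ! a ! j = X ! b ! j then 0 else 1)"

definition Adv :: "nat \<Rightarrow> 'a list list \<Rightarrow> complex mat \<Rightarrow> complex mat \<Rightarrow> real" where
  "Adv n X R S = Sup {opnorm (hadamard G (R - S)) | G.
      G \<in> carrier_mat (length X) (length X) \<and> hermitian G \<and>
      (\<forall>j<n. opnorm (hadamard G (Delta X j)) \<le> 1)}"

definition piecewise_cont :: "real \<Rightarrow> real \<Rightarrow> (real \<Rightarrow> complex) \<Rightarrow> bool" where
  "piecewise_cont a b f \<longleftrightarrow> (\<exists>ts::real list. ts \<noteq> [] \<and> hd ts = a \<and> last ts = b \<and> sorted ts \<and>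
     (\<forall>k < length ts - 1. \<exists>g. continuous_on {ts ! k .. ts ! Suc k} g \<and>
        (\<forall>t \<in> {ts ! k <..< ts ! Suc k}. g t = f t)))"

text \<open>Oracle Hamiltonian H_Q(x) tensor I_w on C^n (x) C^r (x) C^w, extended by 0 on H' = C^d.
  Basis index of |j,s,k> is (j*r + s)*w + k; the indices >= n*r*w belong to H'.\<close>
definition HQ_tilde :: "nat \<Rightarrow> nat \<Rightarrow> nat \<Rightarrow> nat \<Rightarrow> ('a \<Rightarrow> complex mat) \<Rightarrow> 'a list \<Rightarrow> complex mat" where
  "HQ_tilde n r w d h x = mat (n*r*w + d) (n*r*w + d) (\<lambda>(p,q).
     if p < n*r*w \<and> q < n*r*w \<and> p div (r*w) = q div (r*w) \<and> p mod w = q mod w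
     then h (x ! (p div (r*w))) $$ ((p div w) mod r, (q div w) mod r) else 0)"

text \<open>U solves i dU/dt = H(t) U(t), U(0) = I on [0,T] (integral / Caratheodory form).\<close>
definition generated :: "(real \<Rightarrow> complex mat) \<Rightarrow> real \<Rightarrow> nat \<Rightarrow> (real \<Rightarrow> complex mat) \<Rightarrow> bool" where
  "generated H T N U \<longleftrightarrow> (\<forall>t \<in> {0..T}. U t \<in> carrier_mat N N \<and>
     (\<forall>i<N. \<forall>j<N. ((\<lambda>s. (- \<i>) * (H s * U s) $$ (i,j)) has_integral
         (U t $$ (i,j) - (1\<^sub>m N) $$ (i,j))) {0..t}))"

text \<open>There is a continuous-time algorithm of duration T converting R to S with error eps.
  The initial/final states |rho_x,0>, |sigma_x,0> are given directly as unit vectors a k, b k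
  of the algorithm space H = (C^n (x) C^r (x) C^w) (+) C^d.\<close>
definition converts :: "nat \<Rightarrow> nat \<Rightarrow> ('a \<Rightarrow> complex mat) \<Rightarrow> 'a list list \<Rightarrow>
    complex mat \<Rightarrow> complex mat \<Rightarrow> real \<Rightarrow> real \<Rightarrow> bool" where
  "converts n r h X R S eps T \<longleftrightarrow> 0 \<le> T \<and>
    (\<exists>w d (HD :: real \<Rightarrow> complex mat) (\<alpha> :: real \<Rightarrow> real) a b U.
      (\<forall>t \<in> {0..T}. HD t \<in> carrier_mat (n*r*w + d) (n*r*w + d) \<and> hermitian (HD t)) \<and>
      (\<forall>i < n*r*w + d. \<forall>j < n*r*w + d. piecewise_cont 0 T (\<lambda>t. HD t $$ (i,j))) \<and>
      (\<forall>t \<in> {0..T}. \<bar>\<alpha> t\<bar> \<le> 1) \<and>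
      (\<forall>k < length X. a k \<in> unit_vecs (n*r*w + d) \<and> b k \<in> unit_vecs (n*r*w + d)) \<and>
      R = mat (length X) (length X) (\<lambda>(k,l). cinner (a k) (a l)) \<and>
      S = mat (length X) (length X) (\<lambda>(k,l). cinner (b k) (b l)) \<and>
      (\<forall>k < length X.
         generated (\<lambda>t. HD t + complex_of_real (\<alpha> t) \<cdot>\<^sub>m HQ_tilde n r w d h (X ! k)) T (n*r*w + d) (U k) \<and>
         sqrt (1 - eps) \<le> Re (cinner (b k) (U k T *\<^sub>v a k))))"

definition Q_ct :: "nat \<Rightarrow> nat \<Rightarrow> ('a \<Rightarrow> complex mat) \<Rightarrow> 'a list list \<Rightarrow>
    complex mat \<Rightarrow> complex mat \<Rightarrow> real \<Rightarrow> ereal" where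
  "Q_ct n r h X R S eps = (INF T \<in> {T. converts n r h X R S eps T}. ereal T)"

end

theory Submission
  imports Defs "Jordan_Normal_Form.Schur_Decomposition" "Jordan_Normal_Form.Spectral_Radius"
begin

text \<open>
  Let \<open>\<psi>\<^sub>x(t)\<close> be the state of the algorithm on input \<open>x\<close> and \<open>\<rho>(t)\<close> the Gram matrix of these states.
  The derivative of \<open>\<rho>(t)\<close> does not see the driver: its \<open>(x,y)\<close> entry is
  \<open>\<i> \<alpha>(t)\<close> times the matrix element of \<open>H\<^sub>Q(x) - H\<^sub>Q(y)\<close> between \<open>\<psi>\<^sub>x\<close> and \<open>\<psi>\<^sub>y\<close>, and on the block of the query index
  \<open>j\<close> this difference vanishes unless \<open>x\<^sub>j \<noteq> y\<^sub>j\<close>. On that block \<open>\<Gamma>\<close> may hence be replaced by \<open>\<Gamma> \<circ> \<Delta>\<^sub>j\<close>, which is a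
  contraction, and Cauchy-Schwarz over the basis vectors of all blocks bounds \<open>\<Gamma> \<circ> \<rho>'(t)\<close> by 2 in operator norm.
  Integrating gives \<open>Adv(\<rho>(0), \<rho>(T)) \<le> 2 T\<close>.

  In the exact case \<open>\<rho>(T) = \<sigma>\<close>. Otherwise \<open>\<sigma>' = \<rho>(T)\<close> is feasible: \<open>\<sigma> \<circ> u u\<^sup>*\<close> and \<open>\<sigma>' \<circ> u u\<^sup>*\<close> are the Gram matrices of
  the columns of matrices \<open>B\<close>, \<open>C\<close> with \<open>Re tr(B\<^sup>* C) \<ge> sqrt(1 - \<epsilon>)\<close>, and \<open>Re tr(B\<^sup>* C)\<close> is a lower bound of the fidelity of
  \<open>B\<^sup>* B\<close> and \<open>C\<^sup>* C\<close> (the easy half of Uhlmann's theorem).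
\<close>

unbundle no vec_syntax

section \<open>Spectral theorem for Hermitian matrices\<close>

lemma cnorm_eq_L2_set: "cnorm v = L2_set (\<lambda>i. cmod (v $ i)) {..<dim_vec v}"
  by (simp add: cnorm_def L2_set_def)

lemma cnorm_nonneg [simp]: "0 \<le> cnorm v"
  by (simp add: cnorm_eq_L2_set L2_set_nonneg)

lemma cnorm_power2: "(cnorm v)\<^sup>2 = (\<Sum>i<dim_vec v. (cmod (v $ i))\<^sup>2)"
  by (simp add: cnorm_def sum_nonneg)

lemma cinner_self: "cinner v v = of_real ((cnorm v)\<^sup>2)"
  unfolding cinner_def cnorm_power2 of_real_sum
  by (rule sum.cong) (auto simp: complex_norm_square mult.commute simp del: of_real_power)

lemma cnorm_eq_0_iff: "cnorm v = 0 \<longleftrightarrow> v = 0\<^sub>v (dim_vec v)"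
  by (auto simp: cnorm_eq_L2_set L2_set_eq_0_iff intro!: eq_vecI) (metis index_zero_vec(1))

lemma cmod_cinner_le: 
  assumes "dim_vec u = dim_vec v"
  shows "cmod (cinner u v) \<le> cnorm u * cnorm v"
proof -
  have "cmod (cinner u v) \<le> (\<Sum>i<dim_vec u. \<bar>cmod (u $ i)\<bar> * \<bar>cmod (v $ i)\<bar>)"
    unfolding cinner_def by (rule order_trans[OF norm_sum]) (simp add: norm_mult)
  also have "\<dots> \<le> cnorm u * cnorm v"
    unfolding cnorm_eq_L2_set assms by (rule L2_set_mult_ineq)
  finally show ?thesis .
qed

lemma cinner_commute: "dim_vec u = dim_vec v \<Longrightarrow> cinner u v = cnj (cinner v u)"
  by (simp add: cinner_def mult.commute)

lemma cinner_smult_right: "dim_vec u = dim_vec v \<Longrightarrow> cinner u (c \<cdot>\<^sub>v v) = c * cinner u v"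
  by (simp add: cinner_def sum_distrib_left mult_ac)

lemma cinner_smult_left: "cinner (c \<cdot>\<^sub>v u) v = cnj c * cinner u v"
  by (simp add: cinner_def sum_distrib_left mult_ac)

lemma cinner_add_left:
  "dim_vec u = dim_vec u' \<Longrightarrow> cinner (u + u') v = cinner u v + cinner u' v"
  by (simp add: cinner_def sum.distrib algebra_simps)

lemma cinner_add_right:
  "dim_vec u = dim_vec v \<Longrightarrow> dim_vec v = dim_vec v' \<Longrightarrow> cinner u (v + v') = cinner u v + cinner u v'"
  by (simp add: cinner_def sum.distrib algebra_simps)

lemma cinner_minus_right:
  "dim_vec u = dim_vec v \<Longrightarrow> dim_vec v = dim_vec v' \<Longrightarrow> cinner u (v - v') = cinner u v - cinner u v'"
  by (simp add: cinner_def sum_subtractf algebra_simps)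

lemma cnorm_smult: "cnorm (c \<cdot>\<^sub>v v) = cmod c * cnorm v"
  by (simp add: cnorm_def norm_mult power_mult_distrib flip: sum_distrib_left)
     (simp add: real_sqrt_mult)

lemma mult_mat_vec_index_sum:
  "i < dim_row A \<Longrightarrow> dim_col A = dim_vec v \<Longrightarrow> (A *\<^sub>v v) $ i = (\<Sum>j<dim_vec v. A $$ (i,j) * v $ j)"
  by (simp add: scalar_prod_def atLeast0LessThan)

lemma mult_mat_index_sum:
  "i < dim_row A \<Longrightarrow> j < dim_col B \<Longrightarrow> dim_col A = dim_row B \<Longrightarrow>
    (A * B) $$ (i,j) = (\<Sum>k<dim_row B. A $$ (i,k) * B $$ (k,j))"
  by (simp add: scalar_prod_def atLeast0LessThan)

lemma adj_index [simp]: "i < dim_col A \<Longrightarrow> j < dim_row A \<Longrightarrow> adj A $$ (i,j) = cnj (A $$ (j,i))"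
  by (simp add: adj_def)

lemma dim_adj [simp]: "dim_row (adj A) = dim_col A" "dim_col (adj A) = dim_row A"
  by (simp_all add: adj_def)

lemma adj_carrier [simp]: "adj A \<in> carrier_mat n m \<longleftrightarrow> A \<in> carrier_mat m n"
  unfolding carrier_mat_def mem_Collect_eq dim_adj by (rule conj_commute)

lemma adj_adj [simp]: "adj (adj A) = A"
  by (rule eq_matI) auto

lemma adj_one [simp]: "adj (1\<^sub>m n) = 1\<^sub>m n"
  by (rule eq_matI) auto

lemma adj_mult: "dim_col A = dim_row B \<Longrightarrow> adj (A * B) = adj B * adj A"
  by (rule eq_matI) (auto simp: scalar_prod_def mult.commute)

lemma cinner_adj:
  assumes "dim_vec u = dim_row A" "dim_vec v = dim_col A"
  shows "cinner u (A *\<^sub>v v) = cinner (adj A *\<^sub>v u) v"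
  unfolding cinner_def using assms
  by (simp add: scalar_prod_def sum_distrib_left sum_distrib_right mult_ac atLeast0LessThan
        del: index_mult_mat_vec add: mult_mat_vec_index_sum) (rule sum.swap)

lemma cinner_mult_mult:
  assumes "A \<in> carrier_mat k n" "B \<in> carrier_mat k m" "dim_vec u = n" "dim_vec v = m"
  shows "cinner (A *\<^sub>v u) (B *\<^sub>v v) = cinner u ((adj A * B) *\<^sub>v v)"
proof -
  have "cinner u ((adj A * B) *\<^sub>v v) = cinner u (adj A *\<^sub>v (B *\<^sub>v v))"
    using assms by (subst assoc_mult_mat_vec[of _ n k _ m]) (auto intro: carrier_vecI)
  then show ?thesis using assms by (subst (asm) cinner_adj) auto
qed

text \<open>The squared norm of \<open>A *\<^sub>v v\<close> is the quadratic form of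
  \<open>adj A * A\<close> at \<open>v\<close>, so it depends on \<open>A\<close> only through this
  product. The row numbers \<open>k\<close> and \<open>l\<close> may differ, which lets a
  rectangular matrix be compared with the square root of its Gram matrix.\<close>

lemma cnorm_mult_eq:
  assumes "A \<in> carrier_mat k n" "B \<in> carrier_mat l n" "adj A * A = adj B * B" "dim_vec v = n"
  shows "cnorm (A *\<^sub>v v) = cnorm (B *\<^sub>v v)"
proof -
  have "cinner (A *\<^sub>v v) (A *\<^sub>v v) = cinner (B *\<^sub>v v) (B *\<^sub>v v)"
    using assms by (simp add: cinner_mult_mult[of _ k n _ n] cinner_mult_mult[of _ l n _ n])
  then show ?thesis by (simp add: cinner_self del: of_real_power)
qed

lemma cnorm_isometry:
  assumes "U \<in> carrier_mat k n" "adj U * U = 1\<^sub>m n" "dim_vec v = n"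
  shows "cnorm (U *\<^sub>v v) = cnorm v"
proof -
  have "cnorm (U *\<^sub>v v) = cnorm (1\<^sub>m n *\<^sub>v v)"
    by (rule cnorm_mult_eq[OF assms(1) one_carrier_mat _ assms(3)]) (simp_all add: assms(2))
  also have "1\<^sub>m n *\<^sub>v v = v" using carrier_vecI[OF assms(3)] by simp
  finally show ?thesis .
qed

section \<open>Real diagonal matrices\<close>

definition real_diag :: "nat \<Rightarrow> (nat \<Rightarrow> real) \<Rightarrow> complex mat" where
  "real_diag n d = mat n n (\<lambda>(i,j). if i = j then of_real (d i) else 0)"

lemma real_diag_carrier [simp]: "real_diag n d \<in> carrier_mat n n"
  by (simp add: real_diag_def)

lemma dim_real_diag [simp]: "dim_row (real_diag n d) = n" "dim_col (real_diag n d) = n"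
  by (simp_all add: real_diag_def)

lemma real_diag_index [simp]:
  "i < n \<Longrightarrow> j < n \<Longrightarrow> real_diag n d $$ (i,j) = (if i = j then of_real (d i) else 0)"
  by (simp add: real_diag_def)

lemma adj_real_diag [simp]: "adj (real_diag n d) = real_diag n d"
  by (rule eq_matI) auto

lemma mult_real_diag_index:
  "A \<in> carrier_mat m n \<Longrightarrow> i < m \<Longrightarrow> j < n \<Longrightarrow> (A * real_diag n d) $$ (i,j) = A $$ (i,j) * of_real (d j)"
  by (subst mult_mat_index_sum) (auto simp: if_distrib[of "\<lambda>x. _ * x"] cong: if_cong)

lemma real_diag_mult: "real_diag n d * real_diag n e = real_diag n (\<lambda>i. d i * e i)"
  by (rule eq_matI) (auto simp: mult_real_diag_index[of _ n n] simp del: index_mult_mat(1))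

lemma real_diag_mult_vec_index:
  "dim_vec v = n \<Longrightarrow> i < n \<Longrightarrow> (real_diag n d *\<^sub>v v) $ i = of_real (d i) * v $ i"
  by (subst mult_mat_vec_index_sum) (auto simp: if_distrib[of "\<lambda>x. x * _"] cong: if_cong)

text \<open>Complete \<open>v\<close> to a basis, orthogonalise it by Gram-Schmidt, which leaves the
  first vector in place, and normalise the columns. The scalar \<open>c\<close> is the inverse of
  the norm of \<open>v\<close>; its value does not matter when \<open>v\<close> is an
  eigenvector.\<close>

lemma unitary_with_first_column:
  assumes v: "v \<in> carrier_vec n" "v \<noteq> 0\<^sub>v n"
  shows "\<exists>W c. W \<in> carrier_mat n n \<and> adj W * W = 1\<^sub>m n \<and> col W 0 = c \<cdot>\<^sub>v v"
proof -
  interpret cof_vec_space n "TYPE(complex)" .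
  define b where "b = basis_completion v"
  define ws where "ws = gram_schmidt n b"
  have n: "n \<noteq> 0" using v by (cases "n = 0") auto
  note b = basis_completion[OF v, folded b_def]
  from b n obtain vs where bv: "b = v # vs" by (cases b, auto)
  from gram_schmidt_result[OF b(2,4,5) refl, folded ws_def]
  have ws: "set ws \<subseteq> carrier_vec n" "corthogonal ws" "length ws = n" using b by auto
  have hdws: "hd ws = v" unfolding ws_def bv using v by simp
  then have ws0: "ws ! 0 = v" using ws n by (cases ws) auto
  have wsd: "dim_vec (ws ! i) = n" if "i < n" for i using ws that by (auto simp: subset_iff)
  have inner: "cinner (ws ! i) (ws ! j) = (ws ! j) \<bullet>c (ws ! i)" if "i < n" "j < n" for i j
    using that by (simp add: cinner_def scalar_prod_def wsd atLeast0LessThan mult.commute)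
  \<comment> \<open>The equivalence carries two facts: distinct vectors are orthogonal, and no
    \<open>ws ! i\<close> has norm zero, so the division in \<open>W\<close> is harmless.\<close>
  have orth: "cinner (ws ! i) (ws ! j) = 0 \<longleftrightarrow> i \<noteq> j" if "i < n" "j < n" for i j
    using corthogonalD[OF ws(2), of j i] ws(3) that inner by auto
  define W where "W = mat n n (\<lambda>(i,j). (ws ! j) $ i / of_real (cnorm (ws ! j)))"
  have W: "W \<in> carrier_mat n n" by (simp add: W_def)
  have "adj W * W = 1\<^sub>m n"
  proof (rule eq_matI)
    fix i j assume "i < dim_row (1\<^sub>m n :: complex mat)" "j < dim_col (1\<^sub>m n :: complex mat)"
    then have ij: "i < n" "j < n" by auto
    have "(adj W * W) $$ (i,j) = cinner (ws ! i) (ws ! j) / (of_real (cnorm (ws ! i)) * of_real (cnorm (ws ! j)))"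
      using ij W by (subst mult_mat_index_sum) (auto simp: W_def cinner_def wsd sum_divide_distrib)
    also have "\<dots> = 1\<^sub>m n $$ (i,j)"
    proof (cases "i = j")
      case True
      have "cinner (ws ! i) (ws ! i) \<noteq> 0" using orth ij by blast
      then show ?thesis using True ij
        by (simp add: cinner_self power2_eq_square)
    next
      case False
      then show ?thesis using orth ij by simp
    qed
    finally show "(adj W * W) $$ (i,j) = 1\<^sub>m n $$ (i,j)" .
  qed (auto simp: W_def)
  moreover have "col W 0 = (1 / of_real (cnorm v)) \<cdot>\<^sub>v v"
    using n v by (intro eq_vecI) (auto simp: W_def ws0)
  ultimately show ?thesis using W by blast
qed

section \<open>Hermitian matrices and their diagonalisation\<close>

lemma hermitian_carrierD: "hermitian A \<Longrightarrow> A \<in> carrier_mat (dim_row A) (dim_row A)"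
  by (auto simp: hermitian_def)

lemma hermitian_index: 
  assumes "hermitian A" "A \<in> carrier_mat n n" "i < n" "j < n"
  shows "A $$ (i,j) = cnj (A $$ (j,i))"
proof -
  have "A $$ (i,j) = adj A $$ (i,j)" using assms by (simp add: hermitian_def)
  then show ?thesis using assms by simp
qed

lemma hermitianI:
  assumes "A \<in> carrier_mat n n" "\<And>i j. i < n \<Longrightarrow> j < n \<Longrightarrow> A $$ (i,j) = cnj (A $$ (j,i))"
  shows "hermitian A"
proof -
  have "adj A = A"
  proof (rule eq_matI)
    fix i j assume "i < dim_row A" "j < dim_col A"
    then show "adj A $$ (i,j) = A $$ (i,j)" using assms(1) assms(2)[of i j] by simp
  qed (use assms(1) in auto)
  then show ?thesis using assms(1) by (auto simp: hermitian_def)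
qed

lemma hermitian_conj:
  assumes "A \<in> carrier_mat n n" "hermitian A" "W \<in> carrier_mat n m"
  shows "hermitian (adj W * A * W)"
  using assms by (auto simp: hermitian_def adj_mult assoc_mult_mat[of _ m n _ n _ m])

lemma hermitian_eigenvalue_real:
  assumes "A \<in> carrier_mat n n" "hermitian A" "v \<in> carrier_vec n" "v \<noteq> 0\<^sub>v n" "A *\<^sub>v v = e \<cdot>\<^sub>v v"
  shows "e = of_real (Re e)"
proof -
  have "cinner v (A *\<^sub>v v) = cinner (A *\<^sub>v v) v"
    using assms by (subst cinner_adj) (auto simp: hermitian_def)
  then have "e * cinner v v = cnj e * cinner v v"
    using assms by (simp add: cinner_smult_left cinner_smult_right)
  moreover have "cinner v v \<noteq> 0"
    using assms by (auto simp: cinner_self cnorm_eq_0_iff)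
  ultimately have "e = cnj e" by simp
  then show ?thesis by (simp add: complex_eq_iff)
qed

text \<open>Induction on the dimension. A unitary \<open>W\<close> whose first column is an
  eigenvector of \<open>A\<close> turns \<open>A\<close> into a block matrix with the eigenvalue
  \<open>e\<close> in the corner and a Hermitian block \<open>B\<close> of size \<open>n\<close>.
  The induction hypothesis diagonalises \<open>B\<close> by some \<open>U\<close>, and
  \<open>W\<close> times the extension of \<open>U\<close> by a corner entry 1 diagonalises
  \<open>A\<close>.\<close>

theorem hermitian_spectral:
  assumes "A \<in> carrier_mat n n" "hermitian A"
  shows "\<exists>U d. U \<in> carrier_mat n n \<and> adj U * U = 1\<^sub>m n \<and> A * U = U * real_diag n d"
  using assms
proof (induction n arbitrary: A)
  case 0
  show ?case by (rule exI[of _ "1\<^sub>m 0"]) (use 0 in \<open>auto intro!: eq_matI\<close>)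
next
  case (Suc n)
  let ?N = "Suc n"
  note A = Suc.prems(1)
  from spectrum_non_empty[OF A] obtain e v where ev: "eigenvector A v e"
    by (auto simp: spectrum_def eigenvalue_def)
  then have v: "v \<in> carrier_vec ?N" "v \<noteq> 0\<^sub>v ?N" and Av: "A *\<^sub>v v = e \<cdot>\<^sub>v v"
    using A by (auto simp: eigenvector_def)
  have e: "e = of_real (Re e)" by (rule hermitian_eigenvalue_real[OF A Suc.prems(2) v Av])
  from unitary_with_first_column[OF v] obtain W c where
    W: "W \<in> carrier_mat ?N ?N" "adj W * W = 1\<^sub>m ?N" "col W 0 = c \<cdot>\<^sub>v v" by blast
  have WW: "W * adj W = 1\<^sub>m ?N"
    using mat_mult_left_right_inverse[of "adj W" ?N W] W by simp
  define A' where "A' = adj W * A * W"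
  have A': "A' \<in> carrier_mat ?N ?N" using W A by (auto simp: A'_def)
  have hA': "hermitian A'" unfolding A'_def by (rule hermitian_conj[OF A Suc.prems(2) W(1)])
  have AW: "A * W = W * A'"
  proof -
    have "W * A' = (W * adj W) * A * W" unfolding A'_def using W A
      by (simp add: assoc_mult_mat[of _ ?N ?N _ ?N _ ?N])
    then show ?thesis using A by (simp add: WW)
  qed
  have "col A' 0 = adj W *\<^sub>v (A *\<^sub>v col W 0)"
    unfolding A'_def using W(1) A
    by (simp add: assoc_mult_mat[of _ ?N ?N _ ?N _ ?N] col_mult2[of _ ?N ?N _ ?N])
  also have "A *\<^sub>v col W 0 = e \<cdot>\<^sub>v col W 0"
    using A v by (auto simp: W(3) mult_mat_vec[of _ ?N ?N] Av smult_smult_assoc mult.commute)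
  also have "adj W *\<^sub>v (e \<cdot>\<^sub>v col W 0) = e \<cdot>\<^sub>v (adj W *\<^sub>v col W 0)"
    using W(1) v by (intro mult_mat_vec[of _ ?N ?N] carrier_vecI) auto
  also have "adj W *\<^sub>v col W 0 = col (adj W * W) 0" using W(1) by (subst col_mult2[of _ ?N ?N _ ?N]) auto
  also have "\<dots> = unit_vec ?N 0" by (simp add: W(2))
  finally have col0: "col A' 0 = e \<cdot>\<^sub>v unit_vec ?N 0" .
  have c0: "A' $$ (i,0) = (if i = 0 then e else 0)" if "i < ?N" for i
  proof -
    have "A' $$ (i,0) = col A' 0 $ i" using A' that by simp
    then show ?thesis unfolding col0 using that by simp
  qed
  \<comment> \<open>Hermiticity carries the zeros of the first column over to the first row, which
    makes \<open>A'\<close> block diagonal.\<close>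
  have r0: "A' $$ (0,j) = (if j = 0 then e else 0)" if "j < ?N" for j
    using hermitian_index[OF hA' A', of 0 j] c0[OF that] c0[of 0] that by (cases "j = 0") auto
  define B where "B = mat n n (\<lambda>(i,j). A' $$ (Suc i, Suc j))"
  have B: "B \<in> carrier_mat n n" by (simp add: B_def)
  have "hermitian B"
  proof (rule hermitianI[OF B])
    fix i j assume "i < n" "j < n"
    then show "B $$ (i,j) = cnj (B $$ (j,i))"
      unfolding B_def using hermitian_index[OF hA' A', of "Suc i" "Suc j"] by simp
  qed
  from Suc.IH[OF B this] obtain U d where
    U: "U \<in> carrier_mat n n" "adj U * U = 1\<^sub>m n" "B * U = U * real_diag n d" by blast
  define E where "E = mat 1 1 (\<lambda>_. e)"
  have E: "E \<in> carrier_mat 1 1" by (simp add: E_def)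
  let ?z1 = "0\<^sub>m 1 n :: complex mat" and ?z2 = "0\<^sub>m n 1 :: complex mat"
  define U' where "U' = four_block_mat (1\<^sub>m 1) ?z1 ?z2 U"
  have U': "U' \<in> carrier_mat ?N ?N" using U by (auto simp: U'_def)
  have aU': "adj U' = four_block_mat (1\<^sub>m 1) ?z1 ?z2 (adj U)"
    using U by (intro eq_matI) (auto simp: U'_def)
  have one: "four_block_mat (1\<^sub>m 1) ?z1 ?z2 (1\<^sub>m n) = 1\<^sub>m ?N"
    by (intro eq_matI) auto
  have "adj U' * U' = four_block_mat (1\<^sub>m 1) ?z1 ?z2 (1\<^sub>m n)"
    unfolding aU' unfolding U'_def using U
    by (subst mult_four_block_mat[of _ 1 1 _ n _ n]) auto
  then have uU': "adj U' * U' = 1\<^sub>m ?N" by (simp add: one)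
  define d' where "d' i = (case i of 0 \<Rightarrow> Re e | Suc i \<Rightarrow> d i)" for i
  have D': "real_diag ?N d' = four_block_mat E ?z1 ?z2 (real_diag n d)"
    using e by (intro eq_matI) (auto simp: d'_def E_def split: nat.split)
  have A'b: "A' = four_block_mat E ?z1 ?z2 B"
    using A' c0 r0 by (intro eq_matI) (auto simp: E_def B_def)
  have "A' * U' = four_block_mat E ?z1 ?z2 (B * U)"
    unfolding A'b U'_def using U B E
    by (subst mult_four_block_mat[of _ 1 1 _ n _ n]) auto
  also have "\<dots> = U' * real_diag ?N d'"
    unfolding D' U'_def using U B E
    by (subst mult_four_block_mat[of _ 1 1 _ n _ n]) auto
  finally have AU': "A' * U' = U' * real_diag ?N d'" .
  let ?V = "W * U'"
  have "adj ?V * ?V = adj U' * ((adj W * W) * U')"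
    using W(1) U' by (simp add: adj_mult assoc_mult_mat[of _ ?N ?N _ ?N _ ?N])
  then have 1: "adj ?V * ?V = 1\<^sub>m ?N" using U' by (simp add: W(2) uU')
  have "A * ?V = (A * W) * U'" using A W U' by (simp add: assoc_mult_mat[of _ ?N ?N _ ?N _ ?N])
  also have "\<dots> = W * (A' * U')" using A' W U' by (simp add: AW assoc_mult_mat[of _ ?N ?N _ ?N _ ?N])
  also have "\<dots> = ?V * real_diag ?N d'" using W U'
    by (simp add: AU' assoc_mult_mat[of _ ?N ?N _ ?N _ ?N])
  finally show ?case using 1 W U' by (intro exI[of _ ?V] exI[of _ d']) auto
qed

section \<open>Fidelity\<close>

lemma mtrace_mult_comm:
  assumes "A \<in> carrier_mat n m" "B \<in> carrier_mat m n"
  shows "mtrace (A * B) = mtrace (B * A)"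
proof -
  have "mtrace (A * B) = (\<Sum>i<n. \<Sum>j<m. A $$ (i,j) * B $$ (j,i))"
    unfolding mtrace_def using assms by (auto simp: scalar_prod_def atLeast0LessThan)
  also have "\<dots> = (\<Sum>j<m. \<Sum>i<n. B $$ (j,i) * A $$ (i,j))"
    by (subst sum.swap) (simp add: mult.commute)
  also have "\<dots> = mtrace (B * A)"
    unfolding mtrace_def using assms by (auto simp: scalar_prod_def atLeast0LessThan)
  finally show ?thesis .
qed

lemma adj_mult_index:
  assumes "A \<in> carrier_mat k n" "B \<in> carrier_mat k m" "i < n" "j < m"
  shows "(adj A * B) $$ (i,j) = cinner (col A i) (col B j)"
  using assms by (subst mult_mat_index_sum) (auto simp: cinner_def)

lemma col_mult_real_diag:
  assumes "U \<in> carrier_mat k n" "i < n"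
  shows "col (U * real_diag n d) i = of_real (d i) \<cdot>\<^sub>v col U i"
  by (rule eq_vecI)
     (use assms in \<open>auto simp: mult_real_diag_index[of _ k n] mult.commute simp del: index_mult_mat(1)\<close>)

text \<open>The spectral theorem in every form used later: as a factorisation of \<open>A\<close>,
  as an intertwining relation, and through the columns of \<open>U\<close> as unit eigenvectors. The
  identity \<open>U * adj U = 1\<^sub>m n\<close> follows because a left inverse of a square matrix
  is also a right inverse.\<close>

lemma hermitian_spectralE:
  assumes "A \<in> carrier_mat n n" "hermitian A"
  obtains U d where "U \<in> carrier_mat n n" "adj U * U = 1\<^sub>m n" "U * adj U = 1\<^sub>m n"
    "A * U = U * real_diag n d" "A = U * real_diag n d * adj U"
    "\<forall>i<n. A *\<^sub>v col U i = of_real (d i) \<cdot>\<^sub>v col U i"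
    "\<forall>i<n. cnorm (col U i) = 1"
proof -
  from hermitian_spectral[OF assms] obtain U d where
    U: "U \<in> carrier_mat n n" "adj U * U = 1\<^sub>m n" "A * U = U * real_diag n d" by blast
  have UU: "U * adj U = 1\<^sub>m n"
    using mat_mult_left_right_inverse[of "adj U" n U] U by simp
  have "U * real_diag n d * adj U = A * (U * adj U)"
    using U(1) assms(1) by (simp add: U(3)[symmetric] assoc_mult_mat[of _ n n _ n _ n])
  then have A: "A = U * real_diag n d * adj U" using assms(1) by (simp add: UU)
  have ev: "A *\<^sub>v col U i = of_real (d i) \<cdot>\<^sub>v col U i" if "i < n" for i
    using col_mult2[OF assms(1) U(1) that] col_mult_real_diag[OF U(1) that, of d] by (simp add: U(3))
  have nrm: "cnorm (col U i) = 1" if "i < n" for i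
  proof -
    have "cinner (col U i) (col U i) = 1"
      using adj_mult_index[OF U(1) U(1) that that] that by (simp add: U(2))
    then have "(cnorm (col U i))\<^sup>2 = 1"
      unfolding cinner_self of_real_eq_1_iff .
    then show ?thesis using cnorm_nonneg[of "col U i"] by (simp add: power2_eq_1_iff)
  qed
  show thesis using that[OF U(1,2) UU U(3) A] ev nrm by blast
qed

section \<open>Positive semidefinite matrices and their square roots\<close>

lemma psdD:
  fixes v :: cvec
  assumes "psd A"
  shows "hermitian A" "A \<in> carrier_mat (dim_row A) (dim_row A)"
    "dim_vec v = dim_row A \<Longrightarrow> 0 \<le> Re (cinner v (A *\<^sub>v v))"
  using assms hermitian_carrierD by (auto simp: psd_def)

text \<open>The quadratic form of the new matrix at \<open>v\<close> is that of \<open>D\<close> at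
  \<open>W *\<^sub>v v\<close>. \<open>W\<close> may be rectangular.\<close>

lemma psd_conj:
  assumes "psd D" "D \<in> carrier_mat n n" "W \<in> carrier_mat n m"
  shows "psd (adj W * D * W)"
  unfolding psd_def
proof (intro conjI allI impI)
  show "hermitian (adj W * D * W)"
    using assms by (intro hermitian_conj) (auto dest: psdD)
  fix v :: cvec assume "dim_vec v = dim_row (adj W * D * W)"
  then have v: "dim_vec v = m" using assms by simp
  have "adj W * D * W = adj W * (D * W)" using assms by (simp add: assoc_mult_mat[of _ m n _ n _ m])
  then have "cinner v ((adj W * D * W) *\<^sub>v v) = cinner (W *\<^sub>v v) ((D * W) *\<^sub>v v)"
    using assms v by (simp add: cinner_mult_mult[of _ n m _ m])
  also have "(D * W) *\<^sub>v v = D *\<^sub>v (W *\<^sub>v v)"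
    using assms v by (intro assoc_mult_mat_vec[of _ n n _ m]) (auto intro: carrier_vecI)
  finally show "0 \<le> Re (cinner v ((adj W * D * W) *\<^sub>v v))"
    using psdD(3)[OF assms(1), of "W *\<^sub>v v"] assms by simp
qed

lemma psd_real_diag:
  assumes "\<And>i. i < n \<Longrightarrow> 0 \<le> d i"
  shows "psd (real_diag n d)"
  unfolding psd_def
proof (intro conjI allI impI)
  show "hermitian (real_diag n d)" by (simp add: hermitian_def)
  fix v :: cvec assume "dim_vec v = dim_row (real_diag n d)"
  then have v: "dim_vec v = n" by simp
  have "cinner v (real_diag n d *\<^sub>v v) = (\<Sum>i<n. cnj (v $ i) * (of_real (d i) * v $ i))"
    unfolding cinner_def v
    by (rule sum.cong) (auto simp: real_diag_mult_vec_index[OF v] simp del: index_mult_mat_vec)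
  also have "\<dots> = of_real (\<Sum>i<n. d i * (cmod (v $ i))\<^sup>2)"
    by (simp add: complex_norm_square mult_ac del: of_real_power)
  finally have "Re (cinner v (real_diag n d *\<^sub>v v)) = (\<Sum>i<n. d i * (cmod (v $ i))\<^sup>2)"
    by (simp only: Re_complex_of_real)
  also have "0 \<le> \<dots>" using assms by (intro sum_nonneg mult_nonneg_nonneg) auto
  finally show "0 \<le> Re (cinner v (real_diag n d *\<^sub>v v))" .
qed

text \<open>The product is the congruence by \<open>B\<close> of the identity, itself a diagonal
  matrix with nonnegative entries.\<close>

lemma psd_adj_mult:
  assumes "B \<in> carrier_mat n m"
  shows "psd (adj B * B)"
proof -
  have "real_diag n (\<lambda>_. 1) = 1\<^sub>m n" by (rule eq_matI) auto
  then have "psd (1\<^sub>m n)" using psd_real_diag[of n "\<lambda>_. 1"] by simp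
  from psd_conj[OF this one_carrier_mat assms] show ?thesis
    using assms right_mult_one_mat[of "adj B" m n] by simp
qed

lemma psd_eigenvalue_nonneg:
  assumes "psd A" "A \<in> carrier_mat n n" "dim_vec v = n" "cnorm v = 1" "A *\<^sub>v v = of_real e \<cdot>\<^sub>v v"
  shows "0 \<le> e"
  using psdD(3)[OF assms(1), of v] assms
  by (simp add: cinner_smult_right cinner_self)

text \<open>Take square roots of the eigenvalues in an orthonormal eigenbasis.\<close>

lemma psd_sqrt_exists:
  assumes "psd A"
  shows "\<exists>B. psd B \<and> B * B = A"
proof -
  define n where "n = dim_row A"
  have A: "A \<in> carrier_mat n n" and h: "hermitian A"
    unfolding n_def by (rule psdD[OF assms])+
  obtain U d where
    U: "U \<in> carrier_mat n n" "adj U * U = 1\<^sub>m n" "U * adj U = 1\<^sub>m n"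
      "A * U = U * real_diag n d" and AU: "A = U * real_diag n d * adj U"
    and ev: "\<forall>i<n. A *\<^sub>v col U i = of_real (d i) \<cdot>\<^sub>v col U i"
    and nrm: "\<forall>i<n. cnorm (col U i) = 1"
    by (rule hermitian_spectralE[OF A h])
  have d: "0 \<le> d i" if "i < n" for i
    using U(1) that by (intro psd_eigenvalue_nonneg[OF assms A _ nrm[rule_format] ev[rule_format]]) auto
  let ?D = "real_diag n (\<lambda>i. sqrt (d i))"
  let ?B = "U * ?D * adj U"
  note mult_carrier_mat[of _ n n _ n, simp]
  have "psd (adj (adj U) * ?D * adj U)"
    using U(1) d by (intro psd_conj[where n = n and m = n] psd_real_diag) auto
  then have "psd ?B" by simp
  have "?B * ?B = U * (?D * ((adj U * U) * (?D * adj U)))"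
    using U(1) by (simp add: assoc_mult_mat[of _ n n _ n _ n])
  also have "\<dots> = U * ((?D * ?D) * adj U)"
    using U(1) left_mult_one_mat[of "?D * adj U" n n] unfolding U(2)
    by (simp add: assoc_mult_mat[of _ n n _ n _ n])
  also have "?D * ?D = real_diag n d"
    unfolding real_diag_mult by (rule eq_matI) (auto simp: d simp flip: of_real_mult)
  also have "U * (real_diag n d * adj U) = A"
    unfolding AU using U(1) by (simp add: assoc_mult_mat[of _ n n _ n _ n])
  finally show ?thesis using \<open>psd ?B\<close> by blast
qed

text \<open>Let \<open>x\<close> be a unit eigenvector of the Hermitian matrix \<open>B - C\<close>
  with eigenvalue \<open>d i\<close>. Since the squares agree, \<open>B *\<^sub>v x\<close> and
  \<open>C *\<^sub>v x\<close> have equal norms, and expanding this gives \<open>d i\<close> times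
  the sum of the quadratic forms of \<open>B\<close> and \<open>C\<close> at \<open>x\<close> equal
  to 0. If the sum vanishes, both nonnegative forms do, and so does their difference, which is
  \<open>d i\<close>. Thus all eigenvalues of \<open>B - C\<close> are 0.\<close>

lemma psd_sqrt_unique:
  assumes B: "psd B" and C: "psd C" and eq: "B * B = C * C"
  shows "B = C"
proof -
  define n where "n = dim_row B"
  have B': "B \<in> carrier_mat n n" unfolding n_def by (rule psdD(2)[OF B])
  have "dim_row C = n" using arg_cong[OF eq, of dim_row] by (simp add: n_def)
  then have C': "C \<in> carrier_mat n n" using psdD(2)[OF C] by metis
  have BC: "B - C \<in> carrier_mat n n" using B' C' by auto
  have hBC: "hermitian (B - C)"
  proof (rule hermitianI[OF BC])
    fix i j assume ij: "i < n" "j < n"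
    show "(B - C) $$ (i,j) = cnj ((B - C) $$ (j,i))"
      using hermitian_index[OF psdD(1)[OF B] B' ij] hermitian_index[OF psdD(1)[OF C] C' ij] B' C' ij
      by simp
  qed
  obtain U d where
    U: "U \<in> carrier_mat n n" "adj U * U = 1\<^sub>m n" "U * adj U = 1\<^sub>m n"
      "(B - C) * U = U * real_diag n d" and AU: "B - C = U * real_diag n d * adj U"
    and ev: "\<forall>i<n. (B - C) *\<^sub>v col U i = of_real (d i) \<cdot>\<^sub>v col U i"
    and nrm: "\<forall>i<n. cnorm (col U i) = 1"
    by (rule hermitian_spectralE[OF BC hBC])
  have "d i = 0" if i: "i < n" for i
  proof -
    define x where "x = col U i"
    have x: "dim_vec x = n" "x \<in> carrier_vec n" and nx: "cinner x x = 1"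
      using U(1) nrm i by (auto simp: x_def cinner_self)
    have dim: "dim_vec (B *\<^sub>v x) = n" "dim_vec (C *\<^sub>v x) = n" using B' C' by auto
    have "(B - C) *\<^sub>v x = B *\<^sub>v x - C *\<^sub>v x"
      by (rule minus_mult_distrib_mat_vec[OF B' C' x(2)])
    then have e: "B *\<^sub>v x - C *\<^sub>v x = of_real (d i) \<cdot>\<^sub>v x" using ev i by (simp add: x_def)
    have BB: "cinner (B *\<^sub>v x) (B *\<^sub>v x) = cinner x ((B * B) *\<^sub>v x)"
      and CC: "cinner (C *\<^sub>v x) (C *\<^sub>v x) = cinner x ((C * C) *\<^sub>v x)"
      using cinner_mult_mult[OF B' B' x(1) x(1)] cinner_mult_mult[OF C' C' x(1) x(1)]
        psdD(1)[OF B] psdD(1)[OF C] by (auto simp: hermitian_def)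
    have xB: "cinner x (B *\<^sub>v x) = cinner (B *\<^sub>v x) x" and xC: "cinner x (C *\<^sub>v x) = cinner (C *\<^sub>v x) x"
      using cinner_adj[of x B x] cinner_adj[of x C x] B' C' x psdD(1)[OF B] psdD(1)[OF C]
      by (auto simp: hermitian_def)
    have 1: "cinner y (B *\<^sub>v x) - cinner y (C *\<^sub>v x) = of_real (d i) * cinner y x"
      if "dim_vec y = n" for y
      using cinner_minus_right[of y "B *\<^sub>v x" "C *\<^sub>v x"] cinner_smult_right[of y x "of_real (d i)"]
        that dim x e by simp
    have "cinner (B *\<^sub>v x) (C *\<^sub>v x) = cnj (cinner (C *\<^sub>v x) (B *\<^sub>v x))"
      using dim by (intro cinner_commute) simp
    moreover have "cinner (C *\<^sub>v x) (B *\<^sub>v x) = cinner (C *\<^sub>v x) (C *\<^sub>v x) + of_real (d i) * cinner (C *\<^sub>v x) x"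
      using 1[OF dim(2)] by (simp add: algebra_simps)
    moreover have "cinner (B *\<^sub>v x) (B *\<^sub>v x) = cinner (B *\<^sub>v x) (C *\<^sub>v x) + of_real (d i) * cinner (B *\<^sub>v x) x"
      using 1[OF dim(1)] by (simp add: algebra_simps)
    moreover have "cinner (B *\<^sub>v x) (B *\<^sub>v x) = cinner (C *\<^sub>v x) (C *\<^sub>v x)"
      unfolding BB CC eq ..
    moreover have "cnj (cinner (C *\<^sub>v x) (C *\<^sub>v x)) = cinner (C *\<^sub>v x) (C *\<^sub>v x)"
      by (simp add: cinner_self)
    ultimately have "of_real (d i) * cnj (cinner x (C *\<^sub>v x)) + of_real (d i) * cinner x (B *\<^sub>v x) = 0"
      unfolding xB xC by (simp add: algebra_simps)
    then have "Re (of_real (d i) * cnj (cinner x (C *\<^sub>v x)) + of_real (d i) * cinner x (B *\<^sub>v x)) = 0"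
      by simp
    then have "d i * (Re (cinner x (C *\<^sub>v x)) + Re (cinner x (B *\<^sub>v x))) = 0"
      by (simp add: algebra_simps)
    moreover have "0 \<le> Re (cinner x (C *\<^sub>v x))" "0 \<le> Re (cinner x (B *\<^sub>v x))"
      using psdD(3)[OF B, of x] psdD(3)[OF C, of x] B' C' x by auto
    moreover have "Re (cinner x (B *\<^sub>v x)) - Re (cinner x (C *\<^sub>v x)) = d i"
      using arg_cong[OF 1[OF x(1)], of Re] nx by simp
    ultimately show ?thesis by auto
  qed
  then have "real_diag n d = 0\<^sub>m n n" by (intro eq_matI) auto
  then have "B - C = 0\<^sub>m n n" using U(1) by (simp add: AU)
  show ?thesis
  proof (rule eq_matI)
    fix i j assume "i < dim_row C" "j < dim_col C"
    moreover then have "(B - C) $$ (i,j) = 0" using \<open>B - C = 0\<^sub>m n n\<close> C' by simp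
    ultimately show "B $$ (i,j) = C $$ (i,j)" using C' by simp
  qed (use B' C' in auto)
qed

text \<open>Existence and uniqueness together make the definite description in
  \<open>psd_sqrt\<close> denote the positive square root.\<close>

lemma psd_sqrt:
  assumes "psd A"
  shows "psd (psd_sqrt A)" "psd_sqrt A * psd_sqrt A = A"
proof -
  have "\<exists>!B. psd B \<and> B * B = A" using psd_sqrt_exists[OF assms] psd_sqrt_unique by blast
  from theI'[OF this] show "psd (psd_sqrt A)" "psd_sqrt A * psd_sqrt A = A"
    by (auto simp: psd_sqrt_def)
qed

lemma psd_sqrt_carrier:
  assumes "psd A" "A \<in> carrier_mat n n"
  shows "psd_sqrt A \<in> carrier_mat n n"
  using psd_sqrt[OF assms(1)] psdD(2)[of "psd_sqrt A"] assms(2)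
  by (metis carrier_matD(1) index_mult_mat(2))

text \<open>A polar decomposition of \<open>B\<close> with \<open>V\<close> equal to
  \<open>B\<close> times the pseudo-inverse of \<open>s\<close>. \<open>V\<close> vanishes on the
  kernel of \<open>s\<close>, so it is only a contraction, which is all that the Cauchy-Schwarz
  estimate of the fidelity requires.\<close>

lemma polar_contraction:
  assumes B: "B \<in> carrier_mat N m" and s: "s \<in> carrier_mat m m" "hermitian s"
    and eq: "adj B * B = s * s"
  obtains V where "V \<in> carrier_mat N m" "B = V * s" "\<And>x. dim_vec x = m \<Longrightarrow> cnorm (V *\<^sub>v x) \<le> cnorm x"
proof -
  have nB: "cnorm (B *\<^sub>v x) = cnorm (s *\<^sub>v x)" if "dim_vec x = m" for x
    using s eq by (intro cnorm_mult_eq[OF B s(1) _ that]) (simp add: hermitian_def)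
  obtain F p where
    F: "F \<in> carrier_mat m m" "adj F * F = 1\<^sub>m m" "F * adj F = 1\<^sub>m m"
    and sF: "s * F = F * real_diag m p" "s = F * real_diag m p * adj F"
    and ev: "\<forall>i<m. s *\<^sub>v col F i = of_real (p i) \<cdot>\<^sub>v col F i"
    and nrm: "\<forall>i<m. cnorm (col F i) = 1"
    by (rule hermitian_spectralE[OF s])
  let ?E = "real_diag m p"
  \<comment> \<open>Since \<open>inverse 0 = 0\<close>, this is the pseudo-inverse of
    \<open>?E\<close>: it inverts the nonzero eigenvalues and is 0 on the kernel.\<close>
  let ?G = "real_diag m (\<lambda>i. inverse (p i))"
  note mult_carrier_mat[of _ N m _ m, simp] mult_carrier_mat[of _ m m _ m, simp]
  define V where "V = B * F * ?G * adj F"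
  have BF: "B * F \<in> carrier_mat N m" using B F(1) by simp
  have V: "V \<in> carrier_mat N m"
    unfolding V_def using B F(1) by simp
  have BFG: "B * F * ?G \<in> carrier_mat N m" using BF by simp
  have EF: "?E * adj F \<in> carrier_mat m m" using F(1) by simp
  have "adj F * (F * ?E * adj F) = (adj F * F) * (?E * adj F)"
    using F(1) by (simp add: assoc_mult_mat[of _ m m _ m _ m])
  also have "\<dots> = ?E * adj F" unfolding F(2) using EF by (rule left_mult_one_mat)
  finally have "V * s = (B * F * ?G) * (?E * adj F)"
    unfolding V_def sF(2) using BFG F(1) by (subst assoc_mult_mat[of _ N m _ m _ m]) auto
  also have "\<dots> = (B * F * ?G * ?E) * adj F"
    using BFG F(1) by (intro assoc_mult_mat[of _ N m _ m _ m, symmetric]) auto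
  also have "B * F * ?G * ?E = B * F * (?G * ?E)"
    using BF by (intro assoc_mult_mat[of _ N m _ m _ m]) auto
  \<comment> \<open>\<open>?G * ?E\<close> is the projection away from the kernel of
    \<open>s\<close>. Nothing is lost: by \<open>nB\<close>, \<open>B\<close> kills every
    eigenvector that \<open>s\<close> kills, so the missing columns of \<open>B * F\<close> are zero
    already.\<close>
  also have "B * F * (?G * ?E) = B * F"
  proof (rule eq_matI)
    fix i j assume "i < dim_row (B * F)" "j < dim_col (B * F)"
    then have ij: "i < N" "j < m" using B F by auto
    have 1: "(B * F * (?G * ?E)) $$ (i,j) = (B * F) $$ (i,j) * of_real (inverse (p j) * p j)"
      unfolding real_diag_mult by (rule mult_real_diag_index[OF BF ij])
    show "(B * F * (?G * ?E)) $$ (i,j) = (B * F) $$ (i,j)"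
    proof (cases "p j = 0")
      case True
      have "cnorm (B *\<^sub>v col F j) = cnorm (s *\<^sub>v col F j)" using F(1) by (intro nB) simp
      also have "\<dots> = 0" unfolding ev[rule_format, OF ij(2)] True by (simp add: cnorm_smult)
      finally have "B *\<^sub>v col F j = 0\<^sub>v N" using B by (simp add: cnorm_eq_0_iff)
      moreover have "(B * F) $$ (i,j) = (B *\<^sub>v col F j) $ i" using B F(1) ij by simp
      ultimately have "(B * F) $$ (i,j) = 0" using ij by simp
      then show ?thesis unfolding 1 by simp
    next
      case False
      then show ?thesis unfolding 1 by simp
    qed
  qed (use B F in auto)
  also have "B * F * adj F = B"
    using B F(1,3) by (simp add: assoc_mult_mat[of _ N m _ m _ m])
  finally have Vs: "B = V * s" ..
  \<comment> \<open>In the coordinates \<open>y\<close> of \<open>x\<close> with respect to the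
    eigenbasis, \<open>V\<close> has the same effect on norms as \<open>?E\<close> applied to
    \<open>?G *\<^sub>v y\<close>, and each coordinate there is multiplied by 0 or 1.\<close>
  have "cnorm (V *\<^sub>v x) \<le> cnorm x" if x: "dim_vec x = m" for x
  proof -
    define y where "y = adj F *\<^sub>v x"
    have y: "y \<in> carrier_vec m" "dim_vec y = m" using F(1) by (auto simp: y_def intro: carrier_vecI)
    have xc: "x \<in> carrier_vec m" using x by (rule carrier_vecI)
    have ny: "cnorm y = cnorm x" unfolding y_def using F x by (intro cnorm_isometry[of _ m]) auto
    define z where "z = ?G *\<^sub>v y"
    have z: "z \<in> carrier_vec m" "dim_vec z = m" by (auto simp: z_def intro: carrier_vecI)
    have "V *\<^sub>v x = (B * F * ?G) *\<^sub>v y"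
      unfolding V_def y_def using B F(1) xc by (intro assoc_mult_mat_vec[of _ N m _ m]) auto
    also have "\<dots> = (B * F) *\<^sub>v z"
      unfolding z_def using BF y by (intro assoc_mult_mat_vec[of _ N m _ m]) auto
    also have "\<dots> = B *\<^sub>v (F *\<^sub>v z)"
      using B F z by (intro assoc_mult_mat_vec[of _ N m _ m]) auto
    finally have "cnorm (V *\<^sub>v x) = cnorm (s *\<^sub>v (F *\<^sub>v z))"
      using nB[of "F *\<^sub>v z"] F(1) by simp
    also have "s *\<^sub>v (F *\<^sub>v z) = (F * ?E) *\<^sub>v z"
      unfolding sF(1)[symmetric] using s F z by (intro assoc_mult_mat_vec[of _ m m _ m, symmetric]) auto
    also have "\<dots> = F *\<^sub>v (?E *\<^sub>v z)"
      using F z by (intro assoc_mult_mat_vec[of _ m m _ m]) auto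
    also have "cnorm \<dots> = cnorm (?E *\<^sub>v z)"
      using F by (intro cnorm_isometry[of _ m]) auto
    also have "\<dots> \<le> cnorm y"
    proof -
      have "cmod ((?E *\<^sub>v z) $ i) \<le> cmod (y $ i)" if "i < m" for i
      proof -
        have "(?E *\<^sub>v z) $ i = of_real (p i) * (of_real (inverse (p i)) * y $ i)"
          using real_diag_mult_vec_index[OF z(2) that, of p] real_diag_mult_vec_index[OF y(2) that, of "\<lambda>i. inverse (p i)"]
          by (simp only: z_def)
        then show ?thesis by (cases "p i = 0") (simp_all flip: mult.assoc)
      qed
      then show ?thesis unfolding cnorm_eq_L2_set using y(2) by (auto intro: L2_set_mono)
    qed
    finally show ?thesis using ny by simp
  qed
  then show thesis using that[OF V Vs] by blast
qed

text \<open>The easy half of Uhlmann's theorem. Write \<open>B = V * s\<close> with \<open>s\<close>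
  the square root of \<open>adj B * B\<close> and \<open>V\<close> a contraction, so that the trace
  becomes that of \<open>adj V * (C * s)\<close>. Evaluated in an eigenbasis of \<open>M\<close>,
  the square root of \<open>adj (C * s) * (C * s)\<close>, each diagonal term is at most the norm of
  \<open>(C * s) *\<^sub>v e\<close>, which is the eigenvalue of \<open>M\<close> at
  \<open>e\<close>. These eigenvalues sum to the trace of \<open>M\<close>, that is, to the
  fidelity.\<close>

lemma Re_mtrace_le_fidelity:
  assumes B: "B \<in> carrier_mat N m" and C: "C \<in> carrier_mat N m"
  shows "Re (mtrace (adj B * C)) \<le> fidelity (adj B * B) (adj C * C)"
proof -
  define P where "P = adj B * B"
  define Q where "Q = adj C * C"
  have P: "psd P" "P \<in> carrier_mat m m" using psd_adj_mult[OF B] B by (auto simp: P_def)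
  define s where "s = psd_sqrt P"
  have s: "s \<in> carrier_mat m m" "hermitian s" "s * s = P"
    using psd_sqrt[OF P(1)] psd_sqrt_carrier[OF P] psdD by (auto simp: s_def)
  have Cs: "C * s \<in> carrier_mat N m" using C s by simp
  \<comment> \<open>This identifies the matrix under the outer square root of the fidelity as a Gram
    matrix, so \<open>M\<close> below is the absolute value of \<open>C * s\<close>.\<close>
  have sQs: "s * Q * s = adj (C * s) * (C * s)"
    unfolding Q_def using C s
    by (simp add: adj_mult hermitian_def assoc_mult_mat[of _ m m _ m _ m] assoc_mult_mat[of _ m m _ N _ m] assoc_mult_mat[of _ m N _ m _ m])
  have Q2: "psd (s * Q * s)" "s * Q * s \<in> carrier_mat m m"
    unfolding sQs using psd_adj_mult[OF Cs] Cs by auto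
  define M where "M = psd_sqrt (s * Q * s)"
  have M: "M \<in> carrier_mat m m" "psd M" "M * M = adj (C * s) * (C * s)"
    using psd_sqrt[OF Q2(1)] psd_sqrt_carrier[OF Q2] by (auto simp: M_def sQs)
  from polar_contraction[OF B s(1,2)] obtain V where
    V: "V \<in> carrier_mat N m" "B = V * s" and nV: "\<And>x. dim_vec x = m \<Longrightarrow> cnorm (V *\<^sub>v x) \<le> cnorm x"
    using s(3) P_def by metis
  obtain U \<mu> where
    U: "U \<in> carrier_mat m m" "adj U * U = 1\<^sub>m m" "U * adj U = 1\<^sub>m m"
    and MU: "M * U = U * real_diag m \<mu>" "M = U * real_diag m \<mu> * adj U"
    and ev: "\<forall>i<m. M *\<^sub>v col U i = of_real (\<mu> i) \<cdot>\<^sub>v col U i"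
    and nrm: "\<forall>i<m. cnorm (col U i) = 1"
    by (rule hermitian_spectralE[OF M(1) psdD(1)[OF M(2)]])
  have \<mu>: "0 \<le> \<mu> i" if "i < m" for i
    using U(1) that by (intro psd_eigenvalue_nonneg[OF M(2,1) _ nrm[rule_format] ev[rule_format]]) auto
  have trU: "mtrace A = mtrace (adj U * (A * U))" if "A \<in> carrier_mat m m" for A
  proof -
    have "mtrace (adj U * (A * U)) = mtrace (A * U * adj U)"
      using U that by (intro mtrace_mult_comm[of _ m m]) auto
    also have "A * U * adj U = A" using U that by (simp add: assoc_mult_mat[of _ m m _ m _ m])
    finally show ?thesis ..
  qed
  have "mtrace (adj B * C) = mtrace (s * (adj V * C))"
    unfolding V(2) using V(1) s C by (simp add: adj_mult hermitian_def assoc_mult_mat[of _ m m _ N _ m])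
  also have "\<dots> = mtrace (adj V * C * s)"
    using V(1) s C by (intro mtrace_mult_comm[of _ m m]) auto
  also have "\<dots> = mtrace (adj U * (adj V * C * s * U))" using V(1) s C by (intro trU) auto
  also have "adj U * (adj V * C * s * U) = adj (V * U) * (C * s * U)"
    using V(1) s(1) C U(1) by (simp add: adj_mult assoc_mult_mat[of _ m m _ m _ m]
      assoc_mult_mat[of _ m m _ N _ m] assoc_mult_mat[of _ m N _ m _ m] assoc_mult_mat[of _ N m _ m _ m])
  also have "mtrace \<dots> = (\<Sum>i<m. cinner (V *\<^sub>v col U i) ((C * s) *\<^sub>v col U i))"
    unfolding mtrace_def using V(1) U(1) Cs
    by (intro sum.cong) (auto simp: adj_mult_index[of _ N m _ m] col_mult2[of _ N m _ m] simp del: index_mult_mat(1))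
  finally have 1: "mtrace (adj B * C) = (\<Sum>i<m. cinner (V *\<^sub>v col U i) ((C * s) *\<^sub>v col U i))" .
  have 2: "Re (cinner (V *\<^sub>v col U i) ((C * s) *\<^sub>v col U i)) \<le> \<mu> i" if i: "i < m" for i
  proof -
    let ?e = "col U i"
    have e: "dim_vec ?e = m" using U(1) by simp
    have "Re (cinner (V *\<^sub>v ?e) ((C * s) *\<^sub>v ?e)) \<le> cmod (cinner (V *\<^sub>v ?e) ((C * s) *\<^sub>v ?e))"
      by (rule complex_Re_le_cmod)
    also have "\<dots> \<le> cnorm (V *\<^sub>v ?e) * cnorm ((C * s) *\<^sub>v ?e)"
      using V(1) C by (intro cmod_cinner_le) simp
    also have "\<dots> \<le> 1 * cnorm ((C * s) *\<^sub>v ?e)"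
      using nV[OF e] nrm i by (intro mult_right_mono) auto
    also have "cnorm ((C * s) *\<^sub>v ?e) = cnorm (M *\<^sub>v ?e)"
      using psdD(1)[OF M(2)] M(3) by (intro cnorm_mult_eq[OF Cs M(1) _ e]) (simp add: hermitian_def)
    also have "\<dots> = \<mu> i" using ev nrm i \<mu>[OF i] by (simp add: cnorm_smult)
    finally show ?thesis by simp
  qed
  have "mtrace M = mtrace (adj U * (U * real_diag m \<mu>))" using trU[OF M(1)] by (simp only: MU(1))
  also have "adj U * (U * real_diag m \<mu>) = real_diag m \<mu>"
    using U(1,2) by (subst assoc_mult_mat[of _ m m _ m _ m, symmetric]) auto
  finally have "Re (mtrace M) = (\<Sum>i<m. \<mu> i)" by (simp add: mtrace_def)
  moreover have "fidelity (adj B * B) (adj C * C) = Re (mtrace M)"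
    by (simp add: fidelity_def M_def s_def P_def Q_def)
  moreover have "(\<Sum>i<m. Re (cinner (V *\<^sub>v col U i) ((C * s) *\<^sub>v col U i))) \<le> (\<Sum>i<m. \<mu> i)"
    using 2 by (intro sum_mono) simp
  ultimately show ?thesis unfolding 1 by simp
qed

text \<open>Scaling the vectors by the entries of \<open>u\<close> realises both Hadamard products
  as Gram matrices of the columns of \<open>Z b\<close> and \<open>Z c\<close>. The trace of
  \<open>adj (Z b) * Z c\<close> is then the average of the overlaps with the weights
  \<open>(cmod (u $ k))\<^sup>2\<close>, which sum to 1, so its real part is at least
  \<open>x\<close>.\<close>

lemma fid_H_ge:
  assumes "\<And>k. k < m \<Longrightarrow> b k \<in> unit_vecs N" "\<And>k. k < m \<Longrightarrow> c k \<in> unit_vecs N"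
    and le: "\<And>k. k < m \<Longrightarrow> x \<le> Re (cinner (b k) (c k))"
  shows "ereal x \<le> fid_H (mat m m (\<lambda>(k,l). cinner (b k) (b l))) (mat m m (\<lambda>(k,l). cinner (c k) (c l)))"
    (is "_ \<le> fid_H ?S ?S'")
  unfolding fid_H_def
proof (rule INF_greatest)
  fix u assume "u \<in> unit_vecs (dim_row ?S)"
  then have u: "dim_vec u = m" "cnorm u = 1" by (auto simp: unit_vecs_def)
  have dim: "dim_vec (b k) = N" "dim_vec (c k) = N" if "k < m" for k
    using assms(1,2)[OF that] by (auto simp: unit_vecs_def)
  \<comment> \<open>The entries of \<open>u\<close> are conjugated here because \<open>adj\<close>
    conjugates the left factor of the Gram matrix, while \<open>outer u\<close> conjugates the right
    one.\<close>
  define Z where "Z f = mat N m (\<lambda>(i,k). cnj (u $ k) * (f k :: cvec) $ i)" for f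
  have Z: "Z f \<in> carrier_mat N m" for f by (simp add: Z_def)
  have adjZ: "(adj (Z f) * Z g) $$ (k,l) = cinner (f k) (g l) * (u $ k * cnj (u $ l))"
    if "k < m" "l < m" "\<And>k. k < m \<Longrightarrow> dim_vec (f k) = N" for f g k l
    using that by (subst mult_mat_index_sum) (auto simp: Z_def cinner_def sum_distrib_left mult_ac)
  have gram: "adj (Z f) * Z f = hadamard (mat m m (\<lambda>(k,l). cinner (f k) (f l))) (outer u)"
    if "\<And>k. k < m \<Longrightarrow> dim_vec (f k) = N" for f
    by (rule eq_matI)
       (use that Z[of f] u in \<open>auto simp: adjZ hadamard_def outer_def simp del: index_mult_mat(1)\<close>)
  have "x = (\<Sum>k<m. x * (cmod (u $ k))\<^sup>2)"
    using cnorm_power2[of u] u by (simp flip: sum_distrib_left)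
  also have "\<dots> \<le> (\<Sum>k<m. Re (cinner (b k) (c k)) * (cmod (u $ k))\<^sup>2)"
    using le by (intro sum_mono mult_right_mono) auto
  also have "\<dots> = Re (mtrace (adj (Z b) * Z c))"
  proof -
    have "mtrace (adj (Z b) * Z c) = (\<Sum>k<m. cinner (b k) (c k) * (u $ k * cnj (u $ k)))"
      unfolding mtrace_def using Z[of b]
      by (intro sum.cong) (auto simp: adjZ dim simp del: index_mult_mat(1))
    also have "\<dots> = (\<Sum>k<m. cinner (b k) (c k) * of_real ((cmod (u $ k))\<^sup>2))"
      by (simp only: complex_norm_square)
    finally show ?thesis by (simp del: of_real_power)
  qed
  also have "\<dots> \<le> fidelity (adj (Z b) * Z b) (adj (Z c) * Z c)"
    by (rule Re_mtrace_le_fidelity[OF Z Z])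
  also have "\<dots> = fidelity (hadamard ?S (outer u)) (hadamard ?S' (outer u))"
    by (simp add: gram dim)
  finally show "ereal x \<le> ereal (fidelity (hadamard ?S (outer u)) (hadamard ?S' (outer u)))"
    by simp
qed

section \<open>Operator norm and integrated product rule\<close>

lemma cnorm_mult_le_sum:
  assumes "dim_vec v = dim_col A"
  shows "cnorm (A *\<^sub>v v) \<le> (\<Sum>i<dim_row A. \<Sum>j<dim_col A. cmod (A $$ (i,j))) * cnorm v"
proof -
  have "cnorm (A *\<^sub>v v) \<le> (\<Sum>i<dim_row A. cmod ((A *\<^sub>v v) $ i))"
    unfolding cnorm_eq_L2_set by (rule order_trans[OF L2_set_le_sum]) auto
  also have "\<dots> \<le> (\<Sum>i<dim_row A. \<Sum>j<dim_col A. cmod (A $$ (i,j)) * cnorm v)"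
  proof (rule sum_mono)
    fix i assume i: "i \<in> {..<dim_row A}"
    have "cmod ((A *\<^sub>v v) $ i) \<le> (\<Sum>j<dim_col A. cmod (A $$ (i,j) * v $ j))"
      using i assms by (subst mult_mat_vec_index_sum) (auto intro: norm_sum)
    also have "\<dots> \<le> (\<Sum>j<dim_col A. cmod (A $$ (i,j)) * cnorm v)"
      unfolding norm_mult cnorm_eq_L2_set using assms
      by (intro sum_mono mult_left_mono member_le_L2_set) auto
    finally show "cmod ((A *\<^sub>v v) $ i) \<le> (\<Sum>j<dim_col A. cmod (A $$ (i,j)) * cnorm v)" .
  qed
  finally show ?thesis by (simp add: sum_distrib_right)
qed

text \<open>A real supremum yields an upper bound only for a bounded set; the sum of the moduli of
  all entries supplies the bound.\<close>

lemma bdd_above_opnorm: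
  "bdd_above (insert 0 {cnorm (A *\<^sub>v v) | v. v \<in> unit_vecs (dim_col A)})"
proof -
  have "cnorm (A *\<^sub>v v) \<le> (\<Sum>i<dim_row A. \<Sum>j<dim_col A. cmod (A $$ (i,j)))"
    if "v \<in> unit_vecs (dim_col A)" for v
    using cnorm_mult_le_sum[of v A] that by (auto simp: unit_vecs_def)
  then show ?thesis
    by (intro bdd_aboveI[where M = "\<Sum>i<dim_row A. \<Sum>j<dim_col A. cmod (A $$ (i,j))"]) (auto intro!: sum_nonneg)
qed

lemma opnorm_nonneg: "0 \<le> opnorm A"
  unfolding opnorm_def by (rule cSup_upper[OF _ bdd_above_opnorm]) simp

lemma cnorm_mult_le_opnorm:
  assumes "dim_vec v = dim_col A"
  shows "cnorm (A *\<^sub>v v) \<le> opnorm A * cnorm v"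
proof (cases "cnorm v = 0")
  case True
  then show ?thesis using cnorm_mult_le_sum[OF assms] by simp
next
  case False
  let ?v = "of_real (1 / cnorm v) \<cdot>\<^sub>v v"
  have "?v \<in> unit_vecs (dim_col A)"
    using assms False by (simp add: unit_vecs_def cnorm_smult norm_divide)
  then have "cnorm (A *\<^sub>v ?v) \<le> opnorm A"
    unfolding opnorm_def by (intro cSup_upper[OF _ bdd_above_opnorm]) auto
  moreover have "A *\<^sub>v ?v = of_real (1 / cnorm v) \<cdot>\<^sub>v (A *\<^sub>v v)"
    using assms by (intro mult_mat_vec[of _ "dim_row A" "dim_col A"]) (auto intro: carrier_vecI)
  ultimately have "cnorm (A *\<^sub>v v) / cnorm v \<le> opnorm A"
    by (simp add: cnorm_smult norm_divide)
  then show ?thesis using False cnorm_nonneg[of v] by (simp add: field_simps)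
qed

text \<open>Choose \<open>u = A *\<^sub>v v\<close> and cancel one factor of its norm. Bounding the
  sesquilinear form suits the adversary argument, where the form is a double sum over pairs of
  inputs.\<close>

lemma opnorm_leI:
  assumes A: "A \<in> carrier_mat n m" and "0 \<le> c"
    and le: "\<And>u v. dim_vec u = n \<Longrightarrow> dim_vec v = m \<Longrightarrow> cmod (cinner u (A *\<^sub>v v)) \<le> c * (cnorm u * cnorm v)"
  shows "opnorm A \<le> c"
  unfolding opnorm_def
proof (rule cSup_least)
  fix y assume "y \<in> insert 0 {cnorm (A *\<^sub>v v) | v. v \<in> unit_vecs (dim_col A)}"
  then consider "y = 0" | v where "v \<in> unit_vecs (dim_col A)" "y = cnorm (A *\<^sub>v v)" by auto
  then show "y \<le> c"
  proof cases
    case 1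
    then show ?thesis using assms by simp
  next
    case 2
    then have v: "dim_vec v = m" "cnorm v = 1" using A by (auto simp: unit_vecs_def)
    have "cmod (cinner (A *\<^sub>v v) (A *\<^sub>v v)) \<le> c * (cnorm (A *\<^sub>v v) * cnorm v)"
      using A v by (intro le) auto
    then have "y * y \<le> c * y"
      unfolding cinner_self 2(2) by (simp add: v norm_mult power2_eq_square)
    moreover have "0 \<le> y" using 2 by simp
    ultimately show ?thesis using assms(2) by (cases "y = 0") auto
  qed
qed simp

lemma cmod_entry_le_opnorm:
  assumes "A \<in> carrier_mat n m" "i < n" "j < m"
  shows "cmod (A $$ (i,j)) \<le> opnorm A"
proof -
  let ?e = "unit_vec m j :: cvec"
  have "(cnorm ?e)\<^sup>2 = (\<Sum>k<m. if k = j then 1 else 0)"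
    unfolding cnorm_power2 using assms by (intro sum.cong) (auto simp: unit_vec_def)
  then have e: "cnorm ?e = 1" using assms cnorm_nonneg[of ?e] by (simp add: power2_eq_1_iff)
  have "cmod (A $$ (i,j)) = cmod ((A *\<^sub>v ?e) $ i)" using assms by simp
  also have "\<dots> \<le> cnorm (A *\<^sub>v ?e)"
    unfolding cnorm_eq_L2_set using assms by (intro member_le_L2_set) auto
  also have "\<dots> \<le> opnorm A" using cnorm_mult_le_opnorm[of ?e A] assms e by simp
  finally show ?thesis .
qed

text \<open>For fixed \<open>p\<close> the double sum is the form of the contraction
  \<open>M p\<close> between the vectors with entries \<open>u $ x * f x p\<close> and
  \<open>v $ y * g y p\<close>. Cauchy-Schwarz over \<open>p\<close> finishes: the squared norms of
  the first vectors, summed over \<open>p\<close>, are at most that of \<open>u\<close> because each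
  \<open>f x\<close> has norm at most 1, and likewise for \<open>v\<close> and
  \<open>g\<close>.\<close>

lemma opnorm_weighted_sum_le:
  fixes f g :: "nat \<Rightarrow> 'b \<Rightarrow> complex"
  assumes P: "finite P" and M: "\<And>p. p \<in> P \<Longrightarrow> M p \<in> carrier_mat m m" "\<And>p. p \<in> P \<Longrightarrow> opnorm (M p) \<le> 1"
    and u: "dim_vec u = m" and v: "dim_vec v = m"
    and f: "\<And>x. x < m \<Longrightarrow> (\<Sum>p\<in>P. (cmod (f x p))\<^sup>2) \<le> 1"
    and g: "\<And>x. x < m \<Longrightarrow> (\<Sum>p\<in>P. (cmod (g x p))\<^sup>2) \<le> 1"
  shows "cmod (\<Sum>p\<in>P. \<Sum>x<m. \<Sum>y<m. cnj (u $ x) * v $ y * M p $$ (x,y) * (cnj (f x p) * g y p)) \<le> cnorm u * cnorm v"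
proof -
  define U where "U h w p = vec m (\<lambda>x. (w :: cvec) $ x * (h x p :: complex))"
    for h :: "nat \<Rightarrow> 'b \<Rightarrow> complex" and w p
  have dim: "dim_vec (U h w p) = m" for h w p by (simp add: U_def)
  have L2: "L2_set (\<lambda>p. cnorm (U h w p)) P \<le> cnorm w"
    if "dim_vec w = m" "\<And>x. x < m \<Longrightarrow> (\<Sum>p\<in>P. (cmod (h x p))\<^sup>2) \<le> 1" for h w
  proof -
    have "(\<Sum>p\<in>P. (cnorm (U h w p))\<^sup>2) = (\<Sum>p\<in>P. \<Sum>x<m. (cmod (w $ x))\<^sup>2 * (cmod (h x p))\<^sup>2)"
      unfolding cnorm_power2 dim by (simp add: U_def norm_mult power_mult_distrib)
    also have "\<dots> = (\<Sum>x<m. (cmod (w $ x))\<^sup>2 * (\<Sum>p\<in>P. (cmod (h x p))\<^sup>2))"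
      by (subst sum.swap) (simp add: sum_distrib_left)
    also have "\<dots> \<le> (\<Sum>x<m. (cmod (w $ x))\<^sup>2 * 1)"
      using that(2) by (intro sum_mono mult_left_mono) auto
    also have "\<dots> = (cnorm w)\<^sup>2" by (simp add: cnorm_power2 that)
    finally show ?thesis unfolding L2_set_def by (rule real_le_lsqrt[rotated -1]) (auto simp: sum_nonneg)
  qed
  have "cmod (\<Sum>p\<in>P. \<Sum>x<m. \<Sum>y<m. cnj (u $ x) * v $ y * M p $$ (x,y) * (cnj (f x p) * g y p))
      \<le> (\<Sum>p\<in>P. \<bar>cnorm (U f u p)\<bar> * \<bar>cnorm (U g v p)\<bar>)"
  proof (rule order_trans[OF norm_sum sum_mono])
    fix p assume p: "p \<in> P"
    have "(\<Sum>x<m. \<Sum>y<m. cnj (u $ x) * v $ y * M p $$ (x,y) * (cnj (f x p) * g y p))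
        = cinner (U f u p) (M p *\<^sub>v U g v p)"
      unfolding cinner_def using M(1)[OF p]
      by (auto simp: dim scalar_prod_def atLeast0LessThan sum_distrib_left mult_ac U_def intro!: sum.cong)
    also have "cmod \<dots> \<le> cnorm (U f u p) * cnorm (M p *\<^sub>v U g v p)"
      using M(1)[OF p] by (intro cmod_cinner_le) (auto simp: dim)
    also have "\<dots> \<le> cnorm (U f u p) * (1 * cnorm (U g v p))"
    proof (rule mult_left_mono)
      have "cnorm (M p *\<^sub>v U g v p) \<le> opnorm (M p) * cnorm (U g v p)"
        using M(1)[OF p] by (intro cnorm_mult_le_opnorm) (auto simp: dim)
      also have "\<dots> \<le> 1 * cnorm (U g v p)" using M(2)[OF p] by (intro mult_right_mono) auto
      finally show "cnorm (M p *\<^sub>v U g v p) \<le> 1 * cnorm (U g v p)" .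
    qed simp
    finally show "cmod (\<Sum>x<m. \<Sum>y<m. cnj (u $ x) * v $ y * M p $$ (x,y) * (cnj (f x p) * g y p))
      \<le> \<bar>cnorm (U f u p)\<bar> * \<bar>cnorm (U g v p)\<bar>" by simp
  qed
  also have "\<dots> \<le> L2_set (\<lambda>p. cnorm (U f u p)) P * L2_set (\<lambda>p. cnorm (U g v p)) P"
    by (rule L2_set_mult_ineq)
  also have "\<dots> \<le> cnorm u * cnorm v"
    using L2[OF u f] L2[OF v g] by (intro mult_mono) (auto simp: L2_set_nonneg)
  finally show ?thesis .
qed

text \<open>Cut \<open>{0..T}\<close> into \<open>Suc N\<close> equal steps. The linear terms add up
  to \<open>K * T\<close>, the quadratic errors to \<open>C * T\<^sup>2\<close> divided by
  \<open>Suc N\<close>, which tends to 0.\<close>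

lemma norm_increment_le_of_quadratic_error:
  fixes D :: "real \<Rightarrow> complex"
  assumes T: "0 \<le> T" and le: "\<And>s t. 0 \<le> s \<Longrightarrow> s \<le> t \<Longrightarrow> t \<le> T \<Longrightarrow> cmod (D t - D s) \<le> K * (t - s) + C * (t - s)\<^sup>2"
  shows "cmod (D T - D 0) \<le> K * T"
proof -
  have bound: "cmod (D T - D 0) \<le> K * T + C * T\<^sup>2 * inverse (real (Suc N))" for N
  proof -
    define h where "h = T / real (Suc N)"
    have h: "0 \<le> h" "real (Suc N) * h = T" using T by (auto simp: h_def)
    have "D T - D 0 = (\<Sum>i<Suc N. D (real (Suc i) * h) - D (real i * h))"
      using h(2) by (subst sum_lessThan_telescope[of "\<lambda>i. D (real i * h)"]) simp
    also have "cmod \<dots> \<le> (\<Sum>i<Suc N. K * h + C * h\<^sup>2)"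
    proof (rule order_trans[OF norm_sum sum_mono])
      fix i assume "i \<in> {..<Suc N}"
      then have "real (Suc i) * h \<le> T"
        unfolding h(2)[symmetric] using h(1) by (intro mult_right_mono) auto
      moreover have "real (Suc i) * h - real i * h = h" by (simp add: algebra_simps)
      ultimately show "cmod (D (real (Suc i) * h) - D (real i * h)) \<le> K * h + C * h\<^sup>2"
        using le[of "real i * h" "real (Suc i) * h"] h(1) by (simp add: algebra_simps)
    qed
    also have "\<dots> = K * (real (Suc N) * h) + C * (real (Suc N) * h) * h"
      by (simp add: algebra_simps power2_eq_square)
    also have "\<dots> = K * T + C * T\<^sup>2 * inverse (real (Suc N))"
      unfolding h(2) by (simp add: h_def power2_eq_square divide_inverse)
    finally show ?thesis .
  qed
  have "(\<lambda>N. K * T + C * T\<^sup>2 * inverse (real (Suc N))) \<longlonglongrightarrow> K * T + C * T\<^sup>2 * 0"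
    by (intro tendsto_intros LIMSEQ_inverse_real_of_nat)
  then show ?thesis using bound by (intro LIMSEQ_le_const) auto
qed

lemma has_integral_increment:
  fixes F f :: "real \<Rightarrow> complex"
  assumes "\<And>t. 0 \<le> t \<Longrightarrow> t \<le> T \<Longrightarrow> (f has_integral F t - F 0) {0..t}"
    and "0 \<le> s" "s \<le> t" "t \<le> T"
  shows "(f has_integral F t - F s) {s..t}"
proof -
  have "0 \<le> t" "s \<le> T" using assms(2-4) by linarith+
  note t = assms(1)[OF \<open>0 \<le> t\<close> assms(4)] and s = assms(1)[OF assms(2) \<open>s \<le> T\<close>]
  have int: "f integrable_on {s..t}"
    by (rule integrable_subinterval_real[OF has_integral_integrable[OF t]]) (use assms(2-4) in auto)
  have "integral {0..s} f + integral {s..t} f = integral {0..t} f"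
    using has_integral_integrable[OF t] assms(2-4)
    by (intro Henstock_Kurzweil_Integration.integral_combine) auto
  then have "integral {s..t} f = F t - F s"
    using integral_unique[OF t] integral_unique[OF s] by (simp add: algebra_simps)
  then show ?thesis using int by (metis integrable_integral)
qed

text \<open>The product rule in integrated form. The integrands need not be continuous, so the factors
  need not be differentiable; freezing them at the left end of a short interval costs a quadratic error only.\<close>

lemma norm_sum_prod_increment_le:
  fixes F G f g :: "'i \<Rightarrow> real \<Rightarrow> complex"
  assumes I: "finite I" and Z: "finite Z" and T: "0 \<le> T" and B: "0 \<le> B" and K0: "0 \<le> K"
    and F: "\<And>k t. k \<in> I \<Longrightarrow> 0 \<le> t \<Longrightarrow> t \<le> T \<Longrightarrow> (f k has_integral F k t - F k 0) {0..t}"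
    and G: "\<And>k t. k \<in> I \<Longrightarrow> 0 \<le> t \<Longrightarrow> t \<le> T \<Longrightarrow> (g k has_integral G k t - G k 0) {0..t}"
    and f: "\<And>k t. k \<in> I \<Longrightarrow> 0 \<le> t \<Longrightarrow> t \<le> T \<Longrightarrow> t \<notin> Z \<Longrightarrow> cmod (f k t) \<le> B"
    and g: "\<And>k t. k \<in> I \<Longrightarrow> 0 \<le> t \<Longrightarrow> t \<le> T \<Longrightarrow> t \<notin> Z \<Longrightarrow> cmod (g k t) \<le> B"
    and K: "\<And>t. 0 \<le> t \<Longrightarrow> t \<le> T \<Longrightarrow> t \<notin> Z \<Longrightarrow> cmod (\<Sum>k\<in>I. f k t * G k t + F k t * g k t) \<le> K"
  shows "cmod ((\<Sum>k\<in>I. F k T * G k T) - (\<Sum>k\<in>I. F k 0 * G k 0)) \<le> K * T"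
proof (rule norm_increment_le_of_quadratic_error[OF T, where D = "\<lambda>t. \<Sum>k\<in>I. F k t * G k t"])
  fix s t assume st: "0 \<le> s" "s \<le> t" "t \<le> T"
  define n where "n = real (card I)"
  have Fst: "(f k has_integral F k t - F k s) {s..t}" and Gst: "(g k has_integral G k t - G k s) {s..t}"
    if "k \<in> I" "0 \<le> s" "s \<le> t" "t \<le> T" for k s t
    using has_integral_increment[of T "f k" "F k" s t, OF F] has_integral_increment[of T "g k" "G k" s t, OF G] that
    by auto
  \<comment> \<open>Both families are Lipschitz with constant \<open>B\<close>; the finite set
    \<open>Z\<close> does not affect integrals.\<close>
  have Fl: "cmod (F k t - F k s) \<le> B * (t - s)" and Gl: "cmod (G k t - G k s) \<le> B * (t - s)"
    if "k \<in> I" "0 \<le> s" "s \<le> t" "t \<le> T" for k s t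
    using has_integral_bound_real[OF B Z Fst[OF that]] has_integral_bound_real[OF B Z Gst[OF that]] f g that
    by auto
  \<comment> \<open>\<open>?J\<close> is the increment linearised at \<open>s\<close>: one factor
    moves while the other stays frozen. The true increment exceeds it by the products of both
    increments, which are of second order.\<close>
  let ?J = "\<Sum>k\<in>I. (F k t - F k s) * G k s + F k s * (G k t - G k s)"
  have int: "((\<lambda>\<tau>. \<Sum>k\<in>I. f k \<tau> * G k s + F k s * g k \<tau>) has_integral ?J) {s..t}"
    using st by (intro has_integral_sum I has_integral_add has_integral_mult_left has_integral_mult_right Fst Gst) auto
  \<comment> \<open>Unfreezing the factors turns the integrand into the one controlled by
    \<open>K\<close>. By the Lipschitz bounds this costs a term linear in \<open>t - s\<close>,
    hence a quadratic one after integration.\<close>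
  have bd: "cmod (\<Sum>k\<in>I. f k \<tau> * G k s + F k s * g k \<tau>) \<le> K + n * (2 * B\<^sup>2 * (t - s))"
    if \<tau>: "\<tau> \<in> {s..t} - Z" for \<tau>
  proof -
    have "(\<Sum>k\<in>I. f k \<tau> * G k s + F k s * g k \<tau>) = (\<Sum>k\<in>I. f k \<tau> * G k \<tau> + F k \<tau> * g k \<tau>)
        - (\<Sum>k\<in>I. f k \<tau> * (G k \<tau> - G k s) + (F k \<tau> - F k s) * g k \<tau>)"
      unfolding sum_subtractf[symmetric] by (intro sum.cong) (auto simp: algebra_simps)
    also have "cmod \<dots> \<le> K + (\<Sum>k\<in>I. 2 * B\<^sup>2 * (t - s))"
    proof (rule order_trans[OF norm_triangle_ineq4 add_mono])
      show "cmod (\<Sum>k\<in>I. f k \<tau> * G k \<tau> + F k \<tau> * g k \<tau>) \<le> K" using \<tau> st by (intro K) auto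
      show "cmod (\<Sum>k\<in>I. f k \<tau> * (G k \<tau> - G k s) + (F k \<tau> - F k s) * g k \<tau>) \<le> (\<Sum>k\<in>I. 2 * B\<^sup>2 * (t - s))"
      proof (rule order_trans[OF norm_sum sum_mono])
        fix k assume k: "k \<in> I"
        have l: "cmod (G k \<tau> - G k s) \<le> B * (t - s)" "cmod (F k \<tau> - F k s) \<le> B * (t - s)"
          using Gl[OF k, of s \<tau>] Fl[OF k, of s \<tau>] \<tau> st B mult_left_mono[of "\<tau> - s" "t - s" B] by auto
        have "cmod (f k \<tau> * (G k \<tau> - G k s) + (F k \<tau> - F k s) * g k \<tau>)
            \<le> cmod (f k \<tau>) * cmod (G k \<tau> - G k s) + cmod (F k \<tau> - F k s) * cmod (g k \<tau>)"
          by (metis norm_triangle_ineq norm_mult)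
        also have "\<dots> \<le> B * (B * (t - s)) + (B * (t - s)) * B"
          using l f[OF k] g[OF k] \<tau> st B by (intro add_mono mult_mono) auto
        finally show "cmod (f k \<tau> * (G k \<tau> - G k s) + (F k \<tau> - F k s) * g k \<tau>) \<le> 2 * B\<^sup>2 * (t - s)"
          by (simp add: power2_eq_square algebra_simps)
      qed
    qed
    finally show ?thesis by (simp add: n_def)
  qed
  have "0 \<le> K + n * (2 * B\<^sup>2 * (t - s))" using K0 st by (simp add: n_def)
  from has_integral_bound_real[OF this Z int bd]
  have 1: "cmod ?J \<le> (K + n * (2 * B\<^sup>2 * (t - s))) * (t - s)" using st by simp
  have 2: "cmod (\<Sum>k\<in>I. (F k t - F k s) * (G k t - G k s)) \<le> n * (B * (t - s))\<^sup>2"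
  proof -
    have "cmod (\<Sum>k\<in>I. (F k t - F k s) * (G k t - G k s)) \<le> (\<Sum>k\<in>I. (B * (t - s)) * (B * (t - s)))"
      unfolding norm_mult[symmetric] using Fl Gl st B
      by (intro order_trans[OF norm_sum sum_mono]) (auto simp: norm_mult intro!: mult_mono)
    then show ?thesis by (simp add: n_def power2_eq_square)
  qed
  have "(\<Sum>k\<in>I. F k t * G k t) - (\<Sum>k\<in>I. F k s * G k s) = ?J + (\<Sum>k\<in>I. (F k t - F k s) * (G k t - G k s))"
    unfolding sum_subtractf[symmetric] sum.distrib[symmetric] by (intro sum.cong) (auto simp: algebra_simps)
  also have "cmod \<dots> \<le> (K + n * (2 * B\<^sup>2 * (t - s))) * (t - s) + n * (B * (t - s))\<^sup>2"
    by (rule order_trans[OF norm_triangle_ineq add_mono[OF 1 2]])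
  also have "\<dots> = K * (t - s) + (3 * n * B\<^sup>2) * (t - s)\<^sup>2"
    by (simp add: power2_eq_square algebra_simps)
  finally show "cmod ((\<Sum>k\<in>I. F k t * G k t) - (\<Sum>k\<in>I. F k s * G k s)) \<le> K * (t - s) + (3 * n * B\<^sup>2) * (t - s)\<^sup>2" .
qed

text \<open>Induction over the breakpoints: on each closed piece the continuous \<open>g\<close> is
  bounded by compactness and agrees with \<open>f\<close> inside. At the breakpoints
  \<open>f\<close> is unconstrained, so these form the exceptional set \<open>Z\<close>.\<close>

lemma piecewise_cont_bounded:
  assumes "piecewise_cont a b f"
  shows "\<exists>Z B. finite Z \<and> (\<forall>t\<in>{a..b} - Z. cmod (f t) \<le> B)"
proof -
  have *: "\<exists>B. \<forall>t\<in>{hd ts..last ts} - set ts. cmod (f t) \<le> B"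
    if "ts \<noteq> []" "\<forall>k < length ts - 1. \<exists>g. continuous_on {ts ! k .. ts ! Suc k} g \<and>
        (\<forall>t \<in> {ts ! k <..< ts ! Suc k}. g t = f t)" for ts :: "real list"
    using that
  proof (induction ts)
    case (Cons x ts)
    show ?case
    proof (cases ts)
      case Nil
      then show ?thesis by auto
    next
      case (Cons y zs)
      have "\<exists>B. \<forall>t\<in>{hd ts..last ts} - set ts. cmod (f t) \<le> B"
      proof (rule Cons.IH)
        show "\<forall>k < length ts - 1. \<exists>g. continuous_on {ts ! k .. ts ! Suc k} g \<and>
          (\<forall>t \<in> {ts ! k <..< ts ! Suc k}. g t = f t)"
        proof (intro allI impI)
          fix k assume "k < length ts - 1"
          then have "Suc k < length (x # ts) - 1" by simp
          from Cons.prems(2)[rule_format, OF this]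
          show "\<exists>g. continuous_on {ts ! k .. ts ! Suc k} g \<and>
            (\<forall>t \<in> {ts ! k <..< ts ! Suc k}. g t = f t)" by simp
        qed
      qed (simp add: Cons)
      then obtain B1 where B1: "\<forall>t\<in>{hd ts..last ts} - set ts. cmod (f t) \<le> B1" ..
      from Cons.prems(2)[rule_format, of 0] Cons obtain g where
        g: "continuous_on {x..y} g" "\<forall>t\<in>{x<..<y}. g t = f t" by auto
      have "bounded (g ` {x..y})"
        by (intro compact_imp_bounded compact_continuous_image g) simp
      then obtain B2 where B2: "\<forall>t\<in>{x..y}. cmod (g t) \<le> B2" by (auto simp: bounded_iff)
      have "cmod (f t) \<le> max B1 B2" if "t \<in> {x..last ts} - set (x # ts)" for t
      proof (cases "t < y")
        case True
        then have "t \<in> {x<..<y}" "t \<in> {x..y}" using that by auto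
        then show ?thesis using g(2) B2 by (metis max.coboundedI2)
      next
        case False
        then have "t \<in> {hd ts..last ts} - set ts" using that Cons by auto
        then show ?thesis using B1 by (metis max.coboundedI1)
      qed
      then show ?thesis using Cons by (intro exI[of _ "max B1 B2"] ballI) simp
    qed
  qed simp
  from assms obtain ts where "ts \<noteq> []" "hd ts = a" "last ts = b"
    "\<forall>k < length ts - 1. \<exists>g. continuous_on {ts ! k .. ts ! Suc k} g \<and>
        (\<forall>t \<in> {ts ! k <..< ts ! Suc k}. g t = f t)"
    unfolding piecewise_cont_def by blast
  with *[of ts] show ?thesis by (intro exI[of _ "set ts"]) auto
qed

text \<open>\<open>F\<close> is a constant plus an indefinite integral, hence continuous on a
  compact interval.\<close>

lemma bounded_of_has_integral:
  fixes F f :: "real \<Rightarrow> complex"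
  assumes "0 \<le> T" "\<And>t. 0 \<le> t \<Longrightarrow> t \<le> T \<Longrightarrow> (f has_integral F t - F 0) {0..t}"
  shows "\<exists>B. \<forall>t\<in>{0..T}. cmod (F t) \<le> B"
proof -
  have "f integrable_on {0..T}" using assms by blast
  then have "continuous_on {0..T} (\<lambda>t. F 0 + integral {0..t} f)"
    by (intro continuous_intros indefinite_integral_continuous_1)
  then have "bounded ((\<lambda>t. F 0 + integral {0..t} f) ` {0..T})"
    by (intro compact_imp_bounded compact_continuous_image compact_Icc)
  moreover have "F 0 + integral {0..t} f = F t" if "t \<in> {0..T}" for t
    using integral_unique[OF assms(2)[of t]] that by simp
  ultimately show ?thesis by (auto simp: bounded_iff)
qed

section \<open>Schroedinger evolution and the oracle Hamiltonian\<close>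

lemma finite_uniform_bound:
  fixes f :: "'i \<Rightarrow> 'b \<Rightarrow> real"
  assumes "finite A" "\<And>k. k \<in> A \<Longrightarrow> \<exists>B. \<forall>t\<in>S. f k t \<le> B"
  shows "\<exists>B\<ge>0. \<forall>k\<in>A. \<forall>t\<in>S. f k t \<le> B"
proof -
  from assms(2) obtain b where b: "\<And>k t. k \<in> A \<Longrightarrow> t \<in> S \<Longrightarrow> f k t \<le> b k" by metis
  have "f k t \<le> (\<Sum>k\<in>A. \<bar>b k\<bar>)" if "k \<in> A" "t \<in> S" for k t
    using b[OF that] member_le_sum[of k A "\<lambda>k. \<bar>b k\<bar>"] that assms(1) by auto
  then show ?thesis by (intro exI[of _ "\<Sum>k\<in>A. \<bar>b k\<bar>"]) (auto intro: sum_nonneg)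
qed

text \<open>The integrated product rule applied to the coordinates, with one product for each triple
  of two inputs \<open>x\<close>, \<open>y\<close> and a basis index \<open>p\<close>. The summed
  integrand is the formal derivative of the weighted Gram matrix, \<open>\<i>\<close> times the
  difference of the matrix elements of \<open>H x\<close> and \<open>H y\<close>. The weights
  \<open>c\<close> later combine the test vectors with the adversary matrix.\<close>

lemma evolution_gram_increment:
  fixes \<psi> :: "nat \<Rightarrow> real \<Rightarrow> cvec" and H :: "nat \<Rightarrow> real \<Rightarrow> complex mat"
  assumes T: "0 \<le> T" and Z: "finite Z"
    and dim: "\<And>k t. k < m \<Longrightarrow> 0 \<le> t \<Longrightarrow> t \<le> T \<Longrightarrow> dim_vec (\<psi> k t) = N"
    and H: "\<And>k t. k < m \<Longrightarrow> 0 \<le> t \<Longrightarrow> t \<le> T \<Longrightarrow> H k t \<in> carrier_mat N N"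
    and Hb: "\<And>k t p q. k < m \<Longrightarrow> 0 \<le> t \<Longrightarrow> t \<le> T \<Longrightarrow> t \<notin> Z \<Longrightarrow> p < N \<Longrightarrow> q < N \<Longrightarrow> cmod (H k t $$ (p,q)) \<le> Bh"
    and int: "\<And>k p t. k < m \<Longrightarrow> p < N \<Longrightarrow> 0 \<le> t \<Longrightarrow> t \<le> T \<Longrightarrow>
      ((\<lambda>s. - \<i> * (H k s *\<^sub>v \<psi> k s) $ p) has_integral \<psi> k t $ p - \<psi> k 0 $ p) {0..t}"
    and K0: "0 \<le> K"
    and K: "\<And>t. 0 \<le> t \<Longrightarrow> t \<le> T \<Longrightarrow> cmod (\<Sum>x<m. \<Sum>y<m. c x y *
      (\<i> * (cinner (H x t *\<^sub>v \<psi> x t) (\<psi> y t) - cinner (\<psi> x t) (H y t *\<^sub>v \<psi> y t)))) \<le> K"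
  shows "cmod (\<Sum>x<m. \<Sum>y<m. c x y * (cinner (\<psi> x T) (\<psi> y T) - cinner (\<psi> x 0) (\<psi> y 0))) \<le> K * T"
proof -
  define I where "I = {..<m} \<times> {..<m} \<times> {..<N}"
  have I: "finite I" by (simp add: I_def)
  have sumI: "(\<Sum>k\<in>I. f k) = (\<Sum>x<m. \<Sum>y<m. \<Sum>p<N. f (x,y,p))" for f :: "nat \<times> nat \<times> nat \<Rightarrow> complex"
    unfolding I_def by (simp add: sum.cartesian_product')
  have "\<exists>B\<ge>0. \<forall>k\<in>{..<m} \<times> {..<N}. \<forall>t\<in>{0..T}. cmod (\<psi> (fst k) t $ (snd k)) \<le> B"
  proof (rule finite_uniform_bound)
    fix k assume "k \<in> {..<m} \<times> {..<N}"
    then have "fst k < m" "snd k < N" by auto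
    from bounded_of_has_integral[OF T int[OF this]]
    show "\<exists>B. \<forall>t\<in>{0..T}. cmod (\<psi> (fst k) t $ (snd k)) \<le> B" .
  qed simp
  then obtain B1 where B1: "0 \<le> B1" "\<And>k p t. k < m \<Longrightarrow> p < N \<Longrightarrow> 0 \<le> t \<Longrightarrow> t \<le> T \<Longrightarrow> cmod (\<psi> k t $ p) \<le> B1"
    by force
  \<comment> \<open>The one-point set \<open>{()}\<close> turns the uniform bound for functions into
    one for a finite family of constants.\<close>
  have "\<exists>B\<ge>0. \<forall>k\<in>{..<m} \<times> {..<m}. \<forall>t\<in>{()}. cmod (c (fst k) (snd k)) \<le> B"
    by (rule finite_uniform_bound) auto
  then obtain Bc where Bc: "0 \<le> Bc" "\<And>x y. x < m \<Longrightarrow> y < m \<Longrightarrow> cmod (c x y) \<le> Bc" by force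
  define B2 where "B2 = real N * (\<bar>Bh\<bar> * B1)"
  have B2: "0 \<le> B2" using B1 by (simp add: B2_def)
  have fb: "cmod (- \<i> * (H k t *\<^sub>v \<psi> k t) $ p) \<le> B2"
    if "k < m" "p < N" "0 \<le> t" "t \<le> T" "t \<notin> Z" for k p t
  proof -
    have "(H k t *\<^sub>v \<psi> k t) $ p = (\<Sum>q<N. H k t $$ (p,q) * \<psi> k t $ q)"
      using that H[of k t] dim[of k t] by (subst mult_mat_vec_index_sum) auto
    also have "cmod \<dots> \<le> (\<Sum>q<N. \<bar>Bh\<bar> * B1)"
    proof (rule order_trans[OF norm_sum sum_mono])
      fix q assume "q \<in> {..<N}"
      then show "cmod (H k t $$ (p,q) * \<psi> k t $ q) \<le> \<bar>Bh\<bar> * B1"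
        unfolding norm_mult using Hb[OF that(1,3,4,5,2), of q] B1(2)[of k q t] B1(1) that
        by (intro mult_mono) auto
    qed
    finally show ?thesis by (simp add: B2_def norm_mult)
  qed
  define F where "F = (\<lambda>(x,y,p) t. c x y * cnj (\<psi> x t $ p))"
  define f where "f = (\<lambda>(x,y,p) t. c x y * cnj (- \<i> * (H x t *\<^sub>v \<psi> x t) $ p))"
  define G where "G = (\<lambda>(x::nat,y,p) t. \<psi> y t $ p)"
  define g where "g = (\<lambda>(x::nat,y,p) t. - \<i> * (H y t *\<^sub>v \<psi> y t) $ p)"
  have "cmod ((\<Sum>k\<in>I. F k T * G k T) - (\<Sum>k\<in>I. F k 0 * G k 0)) \<le> K * T"
  \<comment> \<open>A single bound must serve both families: \<open>f\<close> carries a weight of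
    modulus at most \<open>Bc\<close>, \<open>g\<close> carries none, and \<open>1 + Bc\<close>
    dominates both factors.\<close>
  proof (rule norm_sum_prod_increment_le[OF I Z T _ K0, where f = f and g = g and B = "(1 + Bc) * B2"])
    show "0 \<le> (1 + Bc) * B2" using Bc B2 by simp
    fix t assume t: "0 \<le> t" "t \<le> T"
    fix k assume "k \<in> I"
    then obtain x y p where k: "k = (x,y,p)" "x < m" "y < m" "p < N" by (auto simp: I_def)
    have "((\<lambda>s. cnj (- \<i> * (H x s *\<^sub>v \<psi> x s) $ p)) has_integral cnj (\<psi> x t $ p - \<psi> x 0 $ p)) {0..t}"
      using has_integral_linear[OF int[OF k(2,4) t] bounded_linear_cnj] by (simp add: o_def)
    from has_integral_mult_right[OF this, of "c x y"]
    show "(f k has_integral F k t - F k 0) {0..t}" by (simp add: k f_def F_def algebra_simps)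
    show "(g k has_integral G k t - G k 0) {0..t}"
      using int[OF k(3,4) t] by (simp add: k g_def G_def)
  next
    fix k t assume "k \<in> I" and t: "0 \<le> t" "t \<le> T" "t \<notin> Z"
    then obtain x y p where k: "k = (x,y,p)" "x < m" "y < m" "p < N" by (auto simp: I_def)
    have "cmod (f k t) = cmod (c x y) * cmod (- \<i> * (H x t *\<^sub>v \<psi> x t) $ p)"
      by (simp add: k f_def norm_mult)
    also have "\<dots> \<le> (1 + Bc) * B2"
      using Bc(2)[OF k(2,3)] Bc(1) fb[OF k(2,4) t] by (intro mult_mono) auto
    finally show "cmod (f k t) \<le> (1 + Bc) * B2" .
    have "cmod (g k t) \<le> 1 * B2" using fb[OF k(3,4) t] by (simp add: k g_def)
    also have "\<dots> \<le> (1 + Bc) * B2" using Bc(1) B2 by (intro mult_right_mono) auto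
    finally show "cmod (g k t) \<le> (1 + Bc) * B2" .
  next
    fix t assume t: "0 \<le> t" "t \<le> T"
    have "(\<Sum>p<N. c x y * cnj (- \<i> * (H x t *\<^sub>v \<psi> x t) $ p) * \<psi> y t $ p
          + c x y * cnj (\<psi> x t $ p) * (- \<i> * (H y t *\<^sub>v \<psi> y t) $ p))
        = c x y * (\<i> * (cinner (H x t *\<^sub>v \<psi> x t) (\<psi> y t) - cinner (\<psi> x t) (H y t *\<^sub>v \<psi> y t)))"
      if "x < m" "y < m" for x y
    proof -
      have d: "dim_vec (H x t *\<^sub>v \<psi> x t) = N" "dim_vec (\<psi> x t) = N"
        using H[OF that(1) t] dim[OF that(1) t] by auto
      show ?thesis unfolding cinner_def d sum_subtractf[symmetric] sum_distrib_left
        by (intro sum.cong) (auto simp: algebra_simps)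
    qed
    then have "(\<Sum>k\<in>I. f k t * G k t + F k t * g k t) = (\<Sum>x<m. \<Sum>y<m. c x y *
      (\<i> * (cinner (H x t *\<^sub>v \<psi> x t) (\<psi> y t) - cinner (\<psi> x t) (H y t *\<^sub>v \<psi> y t))))"
      unfolding sumI f_def F_def g_def G_def by (auto intro!: sum.cong)
    then show "cmod (\<Sum>k\<in>I. f k t * G k t + F k t * g k t) \<le> K" using K[OF t] by simp
  qed
  moreover have "(\<Sum>k\<in>I. F k t * G k t) = (\<Sum>x<m. \<Sum>y<m. c x y * cinner (\<psi> x t) (\<psi> y t))"
    if "0 \<le> t" "t \<le> T" for t
    unfolding sumI F_def G_def using dim that
    by (auto simp: cinner_def sum_distrib_left mult.assoc intro!: sum.cong)
  ultimately show ?thesis using T by (simp add: right_diff_distrib sum_subtractf)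
qed

text \<open>The special case of one state with weight 1: for a Hermitian \<open>H\<close> the two
  matrix elements cancel, so \<open>K = 0\<close> is admissible and the Gram entry stays
  constant.\<close>

lemma cnorm_evolution:
  fixes \<psi> :: "real \<Rightarrow> cvec"
  assumes T: "0 \<le> T" and Z: "finite Z"
    and dim: "\<And>t. 0 \<le> t \<Longrightarrow> t \<le> T \<Longrightarrow> dim_vec (\<psi> t) = N"
    and H: "\<And>t. 0 \<le> t \<Longrightarrow> t \<le> T \<Longrightarrow> H t \<in> carrier_mat N N" "\<And>t. 0 \<le> t \<Longrightarrow> t \<le> T \<Longrightarrow> hermitian (H t)"
    and Hb: "\<And>t p q. 0 \<le> t \<Longrightarrow> t \<le> T \<Longrightarrow> t \<notin> Z \<Longrightarrow> p < N \<Longrightarrow> q < N \<Longrightarrow> cmod (H t $$ (p,q)) \<le> Bh"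
    and int: "\<And>p t. p < N \<Longrightarrow> 0 \<le> t \<Longrightarrow> t \<le> T \<Longrightarrow>
      ((\<lambda>s. - \<i> * (H s *\<^sub>v \<psi> s) $ p) has_integral \<psi> t $ p - \<psi> 0 $ p) {0..t}"
  shows "cnorm (\<psi> T) = cnorm (\<psi> 0)"
proof -
  have "cmod (\<Sum>x<1::nat. \<Sum>y<1::nat. 1 * (cinner (\<psi> T) (\<psi> T) - cinner (\<psi> 0) (\<psi> 0))) \<le> 0 * T"
  proof (rule evolution_gram_increment[OF T Z, where H = "\<lambda>_. H" and \<psi> = "\<lambda>_. \<psi>" and c = "\<lambda>_ _. 1" and N = N and Bh = Bh and m = 1 and K = 0])
    fix t assume t: "0 \<le> t" "t \<le> T"
    have "cinner (\<psi> t) (H t *\<^sub>v \<psi> t) = cinner (H t *\<^sub>v \<psi> t) (\<psi> t)"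
      using H[OF t] dim[OF t] cinner_adj[of "\<psi> t" "H t" "\<psi> t"] by (auto simp: hermitian_def)
    then show "cmod (\<Sum>x<1::nat. \<Sum>y<1::nat. 1 * (\<i> * (cinner (H t *\<^sub>v \<psi> t) (\<psi> t) - cinner (\<psi> t) (H t *\<^sub>v \<psi> t)))) \<le> 0"
      by simp
  qed (use dim H Hb int in auto)
  then have "cinner (\<psi> T) (\<psi> T) = cinner (\<psi> 0) (\<psi> 0)" by simp
  then show ?thesis by (simp add: cinner_self del: of_real_power)
qed

section \<open>The oracle Hamiltonian\<close>

lemma sum_lessThan_mult:
  "(\<Sum>p<a * b. f p) = (\<Sum>i<a. \<Sum>j<b. f (i * b + j))" for a b :: nat and f :: "nat \<Rightarrow> 'c::comm_monoid_add"
proof -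
  have *: "(\<Sum>p<m + n. f p) = (\<Sum>p<m. f p) + (\<Sum>j<n. f (m + j))" for m n
    by (induction n) (auto simp: add.assoc)
  show ?thesis by (induction a) (auto simp: * add.commute[of b])
qed

lemma HQ_tilde_carrier [simp]: "HQ_tilde n r w d h x \<in> carrier_mat (n*r*w + d) (n*r*w + d)"
  by (simp add: HQ_tilde_def)

lemma dim_HQ_tilde [simp]:
  "dim_row (HQ_tilde n r w d h x) = n*r*w + d" "dim_col (HQ_tilde n r w d h x) = n*r*w + d"
  by (simp_all add: HQ_tilde_def)

lemma HQ_tilde_index:
  "p < n*r*w + d \<Longrightarrow> q < n*r*w + d \<Longrightarrow> HQ_tilde n r w d h x $$ (p,q) =
    (if p < n*r*w \<and> q < n*r*w \<and> p div (r*w) = q div (r*w) \<and> p mod w = q mod w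
     then h (x ! (p div (r*w))) $$ ((p div w) mod r, (q div w) mod r) else 0)"
  by (simp add: HQ_tilde_def)

lemma query_index_less: 
  fixes p n r w :: nat assumes "p < n*r*w" shows "p div (r*w) < n"
  using assms by (metis less_mult_imp_div_less mult.assoc)

lemma hermitian_HQ_tilde:
  assumes h: "\<And>j. j < n \<Longrightarrow> h (x ! j) \<in> carrier_mat r r \<and> hermitian (h (x ! j))"
  shows "hermitian (HQ_tilde n r w d h x)"
proof (rule hermitianI[OF HQ_tilde_carrier])
  fix p q assume pq: "p < n*r*w + d" "q < n*r*w + d"
  show "HQ_tilde n r w d h x $$ (p,q) = cnj (HQ_tilde n r w d h x $$ (q,p))"
  proof (cases "p < n*r*w \<and> q < n*r*w \<and> p div (r*w) = q div (r*w) \<and> p mod w = q mod w")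
    case True
    then have "0 < r" by (cases r) auto
    then have s: "(p div w) mod r < r" "(q div w) mod r < r" by auto
    from h[OF query_index_less[of p n r w]] True
    have "h (x ! (p div (r*w))) \<in> carrier_mat r r" "hermitian (h (x ! (p div (r*w))))" by auto
    from hermitian_index[OF this(2,1) s] show ?thesis
      unfolding HQ_tilde_index[OF pq] HQ_tilde_index[OF pq(2,1)] using True by simp
  next
    case False
    then show ?thesis unfolding HQ_tilde_index[OF pq] HQ_tilde_index[OF pq(2,1)] by auto
  qed
qed

lemma cnorm_HQ_tilde_le:
  assumes h: "\<And>j. j < n \<Longrightarrow> h (x ! j) \<in> carrier_mat r r \<and> opnorm (h (x ! j)) \<le> 1"
    and a: "dim_vec a = n*r*w + d"
  shows "cnorm (HQ_tilde n r w d h x *\<^sub>v a) \<le> cnorm a"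
proof -
  let ?Q = "HQ_tilde n r w d h x" and ?W = "n*r*w"
  let ?ix = "\<lambda>j s k. (j * r + s) * w + k"
  define A where "A j k = vec r (\<lambda>s. a $ ?ix j s k)" for j k
  have split: "(\<Sum>p<?W. f p) = (\<Sum>j<n. \<Sum>s<r. \<Sum>k<w. f (?ix j s k))" for f :: "nat \<Rightarrow> 'c::comm_monoid_add"
    by (simp add: sum_lessThan_mult)
  have W: "p < ?W + d" if "p < ?W" for p using that by simp
  have mult_add_less: "i * q + j < p * q" if "i < p" "j < q" for i j p q :: nat
  proof -
    have "i * q + j < Suc i * q" using that by simp
    also have "\<dots> \<le> p * q" using that by (intro mult_le_mono1) simp
    finally show ?thesis .
  qed
  have ix_less: "?ix j s k < ?W" if "j < n" "s < r" "k < w" for j s k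
    by (intro mult_add_less that)
  have ix: "?ix j s k div (r*w) = j" "?ix j s k mod w = k" "?ix j s k div w mod r = s"
    if "j < n" "s < r" "k < w" for j s k
  proof -
    have 1: "?ix j s k div w = j * r + s" using that by simp
    have "?ix j s k div (r*w) = ?ix j s k div w div r" by (metis div_mult2_eq mult.commute)
    then show "?ix j s k div (r*w) = j" unfolding 1 using that by simp
    show "?ix j s k mod w = k" "?ix j s k div w mod r = s" unfolding 1 using that by simp_all
  qed
  have Q_ix: "?Q $$ (?ix j s k, ?ix j' s' k') = (if j' = j \<and> k' = k then h (x ! j) $$ (s,s') else 0)"
    if "j < n" "s < r" "k < w" "j' < n" "s' < r" "k' < w" for j s k j' s' k'
    using ix_less[OF that(1-3)] ix_less[OF that(4-6)]
    unfolding HQ_tilde_index[OF W[OF ix_less[OF that(1-3)]] W[OF ix_less[OF that(4-6)]]]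
      ix[OF that(1-3)] ix[OF that(4-6)] by auto
  have entry: "(?Q *\<^sub>v a) $ ?ix j s k = (h (x ! j) *\<^sub>v A j k) $ s" if jsk: "j < n" "s < r" "k < w" for j s k
  proof -
    let ?p = "?ix j s k" and ?h = "\<lambda>s'. h (x ! j) $$ (s,s')"
    have "(?Q *\<^sub>v a) $ ?p = (\<Sum>q<?W + d. ?Q $$ (?p,q) * a $ q)"
      using a ix_less[OF jsk] by (subst mult_mat_vec_index_sum) auto
    also have "\<dots> = (\<Sum>q<?W. ?Q $$ (?p,q) * a $ q)"
      using ix_less[OF jsk] by (intro sum.mono_neutral_right) (auto simp: HQ_tilde_index)
    also have "\<dots> = (\<Sum>j'<n. \<Sum>s'<r. \<Sum>k'<w. ?Q $$ (?p, ?ix j' s' k') * a $ ?ix j' s' k')"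
      by (rule split)
    also have "\<dots> = (\<Sum>j'<n. if j' = j then \<Sum>s'<r. ?h s' * a $ ?ix j s' k else 0)"
    proof (intro sum.cong refl)
      fix j' assume j': "j' \<in> {..<n}"
      have "(\<Sum>k'<w. ?Q $$ (?p, ?ix j' s' k') * a $ ?ix j' s' k')
          = (\<Sum>k'<w. if k' = k then (if j' = j then ?h s' * a $ ?ix j s' k else 0) else 0)" if "s' < r" for s'
        using that j' jsk by (intro sum.cong refl) (auto simp: Q_ix)
      then have "(\<Sum>s'<r. \<Sum>k'<w. ?Q $$ (?p, ?ix j' s' k') * a $ ?ix j' s' k')
          = (\<Sum>s'<r. if j' = j then ?h s' * a $ ?ix j s' k else 0)"
        using jsk by (intro sum.cong refl) auto
      then show "(\<Sum>s'<r. \<Sum>k'<w. ?Q $$ (?p, ?ix j' s' k') * a $ ?ix j' s' k')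
          = (if j' = j then \<Sum>s'<r. ?h s' * a $ ?ix j s' k else 0)" by auto
    qed
    also have "\<dots> = (\<Sum>s'<r. ?h s' * a $ ?ix j s' k)" using jsk by simp
    also have "\<dots> = (h (x ! j) *\<^sub>v A j k) $ s"
      using h[OF jsk(1)] jsk by (subst mult_mat_vec_index_sum) (auto simp: A_def)
    finally show ?thesis .
  qed
  have "(\<Sum>p<?W + d. (cmod ((?Q *\<^sub>v a) $ p))\<^sup>2) = (\<Sum>p<?W. (cmod ((?Q *\<^sub>v a) $ p))\<^sup>2)"
  proof (intro sum.mono_neutral_right ballI)
    fix p assume p: "p \<in> {..<?W + d} - {..<?W}"
    then have "(?Q *\<^sub>v a) $ p = (\<Sum>q<?W + d. ?Q $$ (p,q) * a $ q)"
      using a by (subst mult_mat_vec_index_sum) auto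
    also have "\<dots> = 0" using p by (intro sum.neutral) (auto simp: HQ_tilde_index)
    finally show "(cmod ((?Q *\<^sub>v a) $ p))\<^sup>2 = 0" by simp
  qed auto
  also have "\<dots> = (\<Sum>j<n. \<Sum>s<r. \<Sum>k<w. (cmod ((h (x ! j) *\<^sub>v A j k) $ s))\<^sup>2)"
    unfolding split by (intro sum.cong) (auto simp: entry simp del: index_mult_mat_vec)
  also have "\<dots> = (\<Sum>j<n. \<Sum>k<w. \<Sum>s<r. (cmod ((h (x ! j) *\<^sub>v A j k) $ s))\<^sup>2)"
    by (intro sum.cong refl sum.swap)
  also have "\<dots> \<le> (\<Sum>j<n. \<Sum>k<w. \<Sum>s<r. (cmod (A j k $ s))\<^sup>2)"
  proof (rule sum_mono, rule sum_mono)
    fix j k assume "j \<in> {..<n}"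
    then have hj: "h (x ! j) \<in> carrier_mat r r" "opnorm (h (x ! j)) \<le> 1" using h by auto
    have "cnorm (h (x ! j) *\<^sub>v A j k) \<le> opnorm (h (x ! j)) * cnorm (A j k)"
      using hj by (intro cnorm_mult_le_opnorm) (simp add: A_def)
    also have "\<dots> \<le> 1 * cnorm (A j k)" using hj by (intro mult_right_mono) auto
    finally have "(cnorm (h (x ! j) *\<^sub>v A j k))\<^sup>2 \<le> (cnorm (A j k))\<^sup>2"
      by (intro power_mono) auto
    then show "(\<Sum>s<r. (cmod ((h (x ! j) *\<^sub>v A j k) $ s))\<^sup>2) \<le> (\<Sum>s<r. (cmod (A j k $ s))\<^sup>2)"
      unfolding cnorm_power2 using hj by (simp add: A_def del: index_mult_mat_vec)
  qed
  also have "\<dots> = (\<Sum>j<n. \<Sum>s<r. \<Sum>k<w. (cmod (A j k $ s))\<^sup>2)"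
    by (intro sum.cong refl sum.swap)
  also have "\<dots> = (\<Sum>p<?W. (cmod (a $ p))\<^sup>2)"
    unfolding split by (intro sum.cong) (auto simp: A_def)
  also have "\<dots> \<le> (\<Sum>p<?W + d. (cmod (a $ p))\<^sup>2)" by (intro sum_mono2) auto
  finally have "(cnorm (?Q *\<^sub>v a))\<^sup>2 \<le> (cnorm a)\<^sup>2"
    unfolding cnorm_power2 using a by (simp del: index_mult_mat_vec)
  then show ?thesis by (rule power2_le_imp_le) simp
qed

text \<open>Bookkeeping that lets weights be compared entry by entry: hermiticity moves
  \<open>Q1\<close> to the other side, and renaming the summation indices of the second term gives
  both terms the same factors of \<open>a\<close> and \<open>b\<close>.\<close>

lemma weighted_commutator_sum:
  assumes Q1: "Q1 \<in> carrier_mat N N" "hermitian Q1" and Q2: "Q2 \<in> carrier_mat N N"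
    and a: "dim_vec a = N" and b: "dim_vec b = N"
  shows "(\<Sum>p<N. \<delta> p * (cnj ((Q1 *\<^sub>v a) $ p) * b $ p - cnj (a $ p) * (Q2 *\<^sub>v b) $ p))
    = (\<Sum>p<N. \<Sum>q<N. cnj (a $ q) * (\<delta> p * Q1 $$ (q,p) - \<delta> q * Q2 $$ (q,p)) * b $ p)"
proof -
  have 1: "cnj ((Q1 *\<^sub>v a) $ p) = (\<Sum>q<N. Q1 $$ (q,p) * cnj (a $ q))" if "p < N" for p
  proof -
    have "cnj ((Q1 *\<^sub>v a) $ p) = (\<Sum>q<N. cnj (Q1 $$ (p,q)) * cnj (a $ q))"
      using that Q1 a by (subst mult_mat_vec_index_sum) auto
    also have "\<dots> = (\<Sum>q<N. Q1 $$ (q,p) * cnj (a $ q))"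
      using hermitian_index[OF Q1(2,1) _ that] by (intro sum.cong) auto
    finally show ?thesis .
  qed
  have 2: "(Q2 *\<^sub>v b) $ p = (\<Sum>q<N. Q2 $$ (p,q) * b $ q)" if "p < N" for p
    using that Q2 b by (subst mult_mat_vec_index_sum) auto
  have "(\<Sum>p<N. \<delta> p * (cnj ((Q1 *\<^sub>v a) $ p) * b $ p - cnj (a $ p) * (Q2 *\<^sub>v b) $ p))
      = (\<Sum>p<N. \<delta> p * ((\<Sum>q<N. Q1 $$ (q,p) * cnj (a $ q)) * b $ p - cnj (a $ p) * (\<Sum>q<N. Q2 $$ (p,q) * b $ q)))"
    by (intro sum.cong refl) (simp add: 1 2 del: index_mult_mat_vec)
  also have "\<dots> = (\<Sum>p<N. \<Sum>q<N. \<delta> p * Q1 $$ (q,p) * cnj (a $ q) * b $ p)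
      - (\<Sum>p<N. \<Sum>q<N. \<delta> p * Q2 $$ (p,q) * cnj (a $ p) * b $ q)"
    by (simp add: right_diff_distrib sum_subtractf sum_distrib_left sum_distrib_right mult_ac)
  also have "(\<Sum>p<N. \<Sum>q<N. \<delta> p * Q2 $$ (p,q) * cnj (a $ p) * b $ q)
      = (\<Sum>p<N. \<Sum>q<N. \<delta> q * Q2 $$ (q,p) * cnj (a $ q) * b $ p)"
    by (rule sum.swap)
  finally show ?thesis unfolding sum_subtractf[symmetric]
    by (simp add: algebra_simps)
qed

lemma oracle_commutator:
  assumes Q1: "Q1 \<in> carrier_mat N N" "hermitian Q1" and Q2: "Q2 \<in> carrier_mat N N"
    and a: "dim_vec a = N" and b: "dim_vec b = N"
    and loc: "\<And>p q. p < N \<Longrightarrow> q < N \<Longrightarrow> Q1 $$ (p,q) \<noteq> 0 \<or> Q2 $$ (p,q) \<noteq> 0 \<Longrightarrow> same p = same q"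
    and eq: "\<And>p q. p < N \<Longrightarrow> q < N \<Longrightarrow> same p \<Longrightarrow> Q1 $$ (p,q) = Q2 $$ (p,q)"
  shows "cinner (Q1 *\<^sub>v a) b - cinner a (Q2 *\<^sub>v b)
    = (\<Sum>p<N. (if same p then 0 else 1) * (cnj ((Q1 *\<^sub>v a) $ p) * b $ p - cnj (a $ p) * (Q2 *\<^sub>v b) $ p))"
proof -
  have "cinner (Q1 *\<^sub>v a) b - cinner a (Q2 *\<^sub>v b)
      = (\<Sum>p<N. 1 * (cnj ((Q1 *\<^sub>v a) $ p) * b $ p - cnj (a $ p) * (Q2 *\<^sub>v b) $ p))"
    unfolding cinner_def using Q1 a by (simp add: sum_subtractf del: index_mult_mat_vec)
  also have "\<dots> = (\<Sum>p<N. \<Sum>q<N. cnj (a $ q) * (1 * Q1 $$ (q,p) - 1 * Q2 $$ (q,p)) * b $ p)"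
    by (rule weighted_commutator_sum[OF Q1 Q2 a b])
  also have "\<dots> = (\<Sum>p<N. \<Sum>q<N. cnj (a $ q) * ((if same p then 0 else 1) * Q1 $$ (q,p)
      - (if same q then 0 else 1) * Q2 $$ (q,p)) * b $ p)"
  proof (intro sum.cong refl arg_cong2[where f = "(*)"])
    fix p q assume "p \<in> {..<N}" "q \<in> {..<N}"
    then show "1 * Q1 $$ (q,p) - 1 * Q2 $$ (q,p) = (if same p then 0 else 1) * Q1 $$ (q,p)
      - (if same q then 0 else 1) * Q2 $$ (q,p)"
      using loc[of q p] eq[of q p] by auto
  qed
  also have "\<dots> = (\<Sum>p<N. (if same p then 0 else 1) * (cnj ((Q1 *\<^sub>v a) $ p) * b $ p - cnj (a $ p) * (Q2 *\<^sub>v b) $ p))"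
    by (rule weighted_commutator_sum[OF Q1 Q2 a b, symmetric])
  finally show ?thesis .
qed

section \<open>The adversary bound\<close>

text \<open>Applying the integral equation for \<open>U\<close> to the fixed vector
  \<open>a\<close>, row by row, gives the integral equation for the state.\<close>

lemma generated_state:
  assumes gen: "generated H T N U" and T: "0 \<le> T"
    and H: "\<And>t. 0 \<le> t \<Longrightarrow> t \<le> T \<Longrightarrow> H t \<in> carrier_mat N N" and a: "a \<in> carrier_vec N"
  shows "U 0 *\<^sub>v a = a"
    and "\<And>p t. p < N \<Longrightarrow> 0 \<le> t \<Longrightarrow> t \<le> T \<Longrightarrow>
      ((\<lambda>s. - \<i> * (H s *\<^sub>v (U s *\<^sub>v a)) $ p) has_integral (U t *\<^sub>v a) $ p - (U 0 *\<^sub>v a) $ p) {0..t}"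
proof -
  have U: "U t \<in> carrier_mat N N" if "0 \<le> t" "t \<le> T" for t
    using gen that by (auto simp: generated_def)
  have int: "((\<lambda>s. - \<i> * (H s * U s) $$ (i,j)) has_integral (U t $$ (i,j) - 1\<^sub>m N $$ (i,j))) {0..t}"
    if "i < N" "j < N" "0 \<le> t" "t \<le> T" for i j t
    using gen that unfolding generated_def by auto
  \<comment> \<open>The initial condition is the integral equation over the degenerate interval
    \<open>{0..0}\<close>.\<close>
  have "U 0 = 1\<^sub>m N"
  proof (rule eq_matI)
    fix i j assume "i < dim_row (1\<^sub>m N :: complex mat)" "j < dim_col (1\<^sub>m N :: complex mat)"
    then show "U 0 $$ (i,j) = 1\<^sub>m N $$ (i,j)"
      using integral_unique[OF int[of i j 0]] T by simp
  qed (use U[of 0] T in auto)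
  then show U0: "U 0 *\<^sub>v a = a" using a by simp
  fix p t assume p: "p < N" and t: "0 \<le> t" "t \<le> T"
  have "((\<lambda>s. \<Sum>j<N. - \<i> * (H s * U s) $$ (p,j) * a $ j) has_integral
      (\<Sum>j<N. (U t $$ (p,j) - 1\<^sub>m N $$ (p,j)) * a $ j)) {0..t}"
    using p t by (intro has_integral_sum has_integral_mult_left int) auto
  also have "(\<Sum>j<N. (U t $$ (p,j) - 1\<^sub>m N $$ (p,j)) * a $ j)
      = (U t *\<^sub>v a) $ p - (1\<^sub>m N *\<^sub>v a) $ p"
    using p a U[OF t] by (simp add: mult_mat_vec_index_sum left_diff_distrib sum_subtractf
        del: index_mult_mat_vec one_mult_mat_vec index_one_mat(1))
  also have "1\<^sub>m N *\<^sub>v a = U 0 *\<^sub>v a" using a U0 by simp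
  finally show "((\<lambda>s. - \<i> * (H s *\<^sub>v (U s *\<^sub>v a)) $ p) has_integral (U t *\<^sub>v a) $ p - (U 0 *\<^sub>v a) $ p) {0..t}"
  proof (rule has_integral_eq[rotated])
    fix s assume "s \<in> {0..t}"
    then have s: "H s \<in> carrier_mat N N" "U s \<in> carrier_mat N N" using t H[of s] U[of s] by auto
    have "H s *\<^sub>v (U s *\<^sub>v a) = (H s * U s) *\<^sub>v a"
      using assoc_mult_mat_vec[OF s a] by simp
    also have "\<dots> $ p = (\<Sum>j<N. (H s * U s) $$ (p,j) * a $ j)"
      using s a p by (subst mult_mat_vec_index_sum) auto
    finally show "(\<Sum>j<N. - \<i> * (H s * U s) $$ (p,j) * a $ j) = - \<i> * (H s *\<^sub>v (U s *\<^sub>v a)) $ p"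
      by (simp add: sum_distrib_left mult.assoc)
  qed
qed

text \<open>The constant 2 comes from the two sums left after inserting the differences of the
  oracle Hamiltonians: in one the oracle acts on the state of \<open>x\<close>, in the other on the
  state of \<open>y\<close>. Each is at most \<open>cnorm u * cnorm v\<close>, because all
  \<open>M p\<close> are contractions and the oracle does not increase norms.\<close>

lemma adversary_derivative_bound:
  fixes n r w d :: nat and X :: "'a list list" and h :: "'a \<Rightarrow> complex mat" and \<alpha> :: real
  defines "N \<equiv> n*r*w + d" and "m \<equiv> length X"
  assumes h: "\<And>x j. x < m \<Longrightarrow> j < n \<Longrightarrow>
      h (X ! x ! j) \<in> carrier_mat r r \<and> hermitian (h (X ! x ! j)) \<and> opnorm (h (X ! x ! j)) \<le> 1"
    and G: "G \<in> carrier_mat m m" "\<And>j. j < n \<Longrightarrow> opnorm (hadamard G (Delta X j)) \<le> 1"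
    and \<psi>: "\<And>x. x < m \<Longrightarrow> dim_vec (\<psi> x) = N" "\<And>x. x < m \<Longrightarrow> cnorm (\<psi> x) = 1"
    and HD: "HD \<in> carrier_mat N N" "hermitian HD" and \<alpha>: "\<bar>\<alpha>\<bar> \<le> 1"
    and u: "dim_vec u = m" and v: "dim_vec v = m"
    and Hdef: "\<And>x. H x = HD + complex_of_real \<alpha> \<cdot>\<^sub>m HQ_tilde n r w d h (X ! x)"
  shows "cmod (\<Sum>x<m. \<Sum>y<m. (cnj (u $ x) * v $ y * G $$ (x,y)) *
    (\<i> * (cinner (H x *\<^sub>v \<psi> x) (\<psi> y) - cinner (\<psi> x) (H y *\<^sub>v \<psi> y)))) \<le> 2 * (cnorm u * cnorm v)"
proof -
  let ?W = "n*r*w"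
  define Q where "Q x = HQ_tilde n r w d h (X ! x)" for x
  have Q: "Q x \<in> carrier_mat N N" for x by (simp add: Q_def N_def)
  have hQ: "hermitian (Q x)" if "x < m" for x
    unfolding Q_def using h[OF that] by (intro hermitian_HQ_tilde) auto
  define \<phi> where "\<phi> x = Q x *\<^sub>v \<psi> x" for x
  have \<phi>d: "dim_vec (\<phi> x) = N" for x using Q[of x] by (simp add: \<phi>_def)
  have \<phi>n: "cnorm (\<phi> x) \<le> 1" if "x < m" for x
    using cnorm_HQ_tilde_le[of n h "X ! x" r "\<psi> x" w d] h[OF that] \<psi>[OF that]
    by (simp add: \<phi>_def Q_def N_def)
  \<comment> \<open>\<open>p div (r*w)\<close> recovers the query index \<open>j\<close> from the
    basis index \<open>p\<close>.\<close>
  define D where "D p x y = (Delta X (p div (r*w)) $$ (x,y) :: complex)" for p x y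
  have diff: "cinner (H x *\<^sub>v \<psi> x) (\<psi> y) - cinner (\<psi> x) (H y *\<^sub>v \<psi> y)
      = of_real \<alpha> * (\<Sum>p<?W. D p x y * (cnj (\<phi> x $ p) * \<psi> y $ p - cnj (\<psi> x $ p) * \<phi> y $ p))"
    if xy: "x < m" "y < m" for x y
  proof -
    have Hx: "H x *\<^sub>v \<psi> x = HD *\<^sub>v \<psi> x + of_real \<alpha> \<cdot>\<^sub>v \<phi> x" if "x < m" for x
    proof -
      have c: "\<psi> x \<in> carrier_vec N" using \<psi>(1)[OF that] by (rule carrier_vecI)
      have "H x *\<^sub>v \<psi> x = HD *\<^sub>v \<psi> x + (of_real \<alpha> \<cdot>\<^sub>m Q x) *\<^sub>v \<psi> x"
        unfolding Hdef Q_def[symmetric] using Q c by (intro add_mult_distrib_mat_vec[OF HD(1)]) auto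
      also have "(of_real \<alpha> \<cdot>\<^sub>m Q x) *\<^sub>v \<psi> x = of_real \<alpha> \<cdot>\<^sub>v \<phi> x"
        unfolding \<phi>_def using Q[of x] c by (intro eq_vecI) (auto simp: smult_scalar_prod_distrib[of _ N])
      finally show ?thesis .
    qed
    have dHD: "dim_row HD = N" using HD by simp
    have 1: "cinner (H x *\<^sub>v \<psi> x) (\<psi> y) = cinner (HD *\<^sub>v \<psi> x) (\<psi> y) + of_real \<alpha> * cinner (\<phi> x) (\<psi> y)"
      unfolding Hx[OF xy(1)] by (simp add: cinner_add_left cinner_smult_left dHD \<phi>d)
    have 2: "cinner (\<psi> x) (H y *\<^sub>v \<psi> y) = cinner (\<psi> x) (HD *\<^sub>v \<psi> y) + of_real \<alpha> * cinner (\<psi> x) (\<phi> y)"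
      unfolding Hx[OF xy(2)] by (simp add: cinner_add_right cinner_smult_right dHD \<phi>d \<psi>(1) xy)
    \<comment> \<open>The driver is Hermitian and common to both inputs, so its contributions
      cancel.\<close>
    have 3: "cinner (\<psi> x) (HD *\<^sub>v \<psi> y) = cinner (HD *\<^sub>v \<psi> x) (\<psi> y)"
      using HD \<psi>(1) xy cinner_adj[of "\<psi> x" HD "\<psi> y"] by (simp add: hermitian_def)
    \<comment> \<open>Coordinates of the extra summand count as \<open>same\<close>, since both
      oracle Hamiltonians vanish there.\<close>
    define same where "same p \<longleftrightarrow> \<not> (p < ?W \<and> X ! x ! (p div (r*w)) \<noteq> X ! y ! (p div (r*w)))" for p
    have "cinner (\<phi> x) (\<psi> y) - cinner (\<psi> x) (\<phi> y)
      = (\<Sum>p<N. (if same p then 0 else 1) * (cnj (\<phi> x $ p) * \<psi> y $ p - cnj (\<psi> x $ p) * \<phi> y $ p))"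
      unfolding \<phi>_def
    proof (rule oracle_commutator[OF Q hQ[OF xy(1)] Q \<psi>(1)[OF xy(1)] \<psi>(1)[OF xy(2)]])
      fix p q assume pq: "p < N" "q < N"
      note ix = HQ_tilde_index[OF pq[unfolded N_def]]
      show "same p = same q" if "Q x $$ (p,q) \<noteq> 0 \<or> Q y $$ (p,q) \<noteq> 0"
        using that unfolding Q_def ix same_def by (auto split: if_splits)
      show "Q x $$ (p,q) = Q y $$ (p,q)" if "same p"
        using that unfolding Q_def ix same_def by auto
    qed
    also have "\<dots> = (\<Sum>p<?W. (if same p then 0 else 1) * (cnj (\<phi> x $ p) * \<psi> y $ p - cnj (\<psi> x $ p) * \<phi> y $ p))"
      by (intro sum.mono_neutral_right) (auto simp: N_def same_def)
    also have "\<dots> = (\<Sum>p<?W. D p x y * (cnj (\<phi> x $ p) * \<psi> y $ p - cnj (\<psi> x $ p) * \<phi> y $ p))"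
      using xy by (intro sum.cong refl) (auto simp: same_def D_def Delta_def m_def)
    finally show ?thesis unfolding 1 2 3 add_diff_cancel_left right_diff_distrib[of "of_real \<alpha>", symmetric]
      by (rule arg_cong)
  qed
  \<comment> \<open>The factor \<open>D p x y\<close> is absorbed into \<open>G\<close>, which makes
    the constraint on the adversary matrix at the query index of \<open>p\<close>
    applicable.\<close>
  define M where "M p = hadamard G (Delta X (p div (r*w)))" for p
  have M: "M p \<in> carrier_mat m m" for p using G(1) by (auto simp: M_def hadamard_def)
  have MD: "M p $$ (x,y) = G $$ (x,y) * D p x y" if "x < m" "y < m" for p x y
    using that G(1) by (auto simp: M_def hadamard_def D_def)
  have M1: "opnorm (M p) \<le> 1" if "p \<in> {..<?W}" for p
    unfolding M_def using that by (intro G(2) query_index_less) simp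
  let ?S = "\<lambda>f g. \<Sum>p<?W. \<Sum>x<m. \<Sum>y<m. cnj (u $ x) * v $ y * M p $$ (x,y) * (cnj (f x $ p) * g y $ p)"
  have part: "(\<Sum>p<?W. (cmod (z $ p))\<^sup>2) \<le> 1" if "dim_vec z = N" "cnorm z \<le> 1" for z :: cvec
  proof -
    have "(\<Sum>p<?W. (cmod (z $ p))\<^sup>2) \<le> (\<Sum>p<N. (cmod (z $ p))\<^sup>2)"
      unfolding N_def by (intro sum_mono2) auto
    also have "\<dots> = (cnorm z)\<^sup>2" by (simp add: cnorm_power2 that)
    also have "\<dots> \<le> 1" using that by (simp add: power_le_one)
    finally show ?thesis .
  qed
  have S1: "cmod (?S \<phi> \<psi>) \<le> cnorm u * cnorm v"
    using \<phi>n \<phi>d \<psi> by (intro opnorm_weighted_sum_le M M1 u v part) auto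
  have S2: "cmod (?S \<psi> \<phi>) \<le> cnorm u * cnorm v"
    using \<phi>n \<phi>d \<psi> by (intro opnorm_weighted_sum_le M M1 u v part) auto
  have swap: "(\<Sum>p<?W. \<Sum>x<m. \<Sum>y<m. f p x y) = (\<Sum>x<m. \<Sum>y<m. \<Sum>p<?W. f p x y)" for f :: "nat \<Rightarrow> nat \<Rightarrow> nat \<Rightarrow> complex"
    by (subst sum.swap) (intro sum.cong refl sum.swap)
  have "(\<Sum>x<m. \<Sum>y<m. (cnj (u $ x) * v $ y * G $$ (x,y)) *
      (\<i> * (cinner (H x *\<^sub>v \<psi> x) (\<psi> y) - cinner (\<psi> x) (H y *\<^sub>v \<psi> y))))
    = \<i> * of_real \<alpha> * (?S \<phi> \<psi> - ?S \<psi> \<phi>)"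
  proof -
    have "(cnj (u $ x) * v $ y * G $$ (x,y)) *
        (\<i> * (cinner (H x *\<^sub>v \<psi> x) (\<psi> y) - cinner (\<psi> x) (H y *\<^sub>v \<psi> y)))
      = \<i> * of_real \<alpha> * ((\<Sum>p<?W. cnj (u $ x) * v $ y * M p $$ (x,y) * (cnj (\<phi> x $ p) * \<psi> y $ p))
          - (\<Sum>p<?W. cnj (u $ x) * v $ y * M p $$ (x,y) * (cnj (\<psi> x $ p) * \<phi> y $ p)))"
      if "x < m" "y < m" for x y
      unfolding diff[OF that] MD[OF that] sum_subtractf[symmetric] sum_distrib_left
      by (intro sum.cong refl) (simp add: right_diff_distrib)
    then show ?thesis
      unfolding swap by (simp only: sum_subtractf[symmetric] sum_distrib_left) (auto intro!: sum.cong)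
  qed
  then have eq: "cmod (\<Sum>x<m. \<Sum>y<m. (cnj (u $ x) * v $ y * G $$ (x,y)) *
      (\<i> * (cinner (H x *\<^sub>v \<psi> x) (\<psi> y) - cinner (\<psi> x) (H y *\<^sub>v \<psi> y))))
    = \<bar>\<alpha>\<bar> * cmod (?S \<phi> \<psi> - ?S \<psi> \<phi>)"
    by (simp only: norm_mult norm_ii norm_of_real mult_1_left)
  have "\<bar>\<alpha>\<bar> * cmod (?S \<phi> \<psi> - ?S \<psi> \<phi>) \<le> 1 * (cnorm u * cnorm v + cnorm u * cnorm v)"
    by (rule mult_mono[OF \<alpha> order_trans[OF norm_triangle_ineq4 add_mono[OF S1 S2]]]) simp_all
  then show ?thesis unfolding eq by simp
qed

section \<open>Feasible adversary matrices and the quantity \<open>Adv\<close>\<close>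

lemma opnorm_le_sum: "opnorm A \<le> (\<Sum>i<dim_row A. \<Sum>j<dim_col A. cmod (A $$ (i,j)))"
  unfolding opnorm_def
proof (rule cSup_least)
  fix y assume "y \<in> insert 0 {cnorm (A *\<^sub>v v) | v. v \<in> unit_vecs (dim_col A)}"
  then show "y \<le> (\<Sum>i<dim_row A. \<Sum>j<dim_col A. cmod (A $$ (i,j)))"
    using cnorm_mult_le_sum[of _ A] by (force simp: unit_vecs_def intro!: sum_nonneg)
qed simp

definition adv_feasible :: "nat \<Rightarrow> 'a list list \<Rightarrow> complex mat \<Rightarrow> bool" where
  "adv_feasible n X G \<longleftrightarrow> G \<in> carrier_mat (length X) (length X) \<and> hermitian G \<and>
      (\<forall>j<n. opnorm (hadamard G (Delta X j)) \<le> 1)"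

lemma Adv_altdef: "Adv n X R S = Sup {opnorm (hadamard G (R - S)) | G. adv_feasible n X G}"
  by (simp add: Adv_def adv_feasible_def)

text \<open>Keeps the set under the supremum in \<open>Adv\<close> nonempty.\<close>

lemma adv_feasible_zero: "adv_feasible n X (0\<^sub>m (length X) (length X))"
proof -
  have "opnorm (hadamard (0\<^sub>m (length X) (length X)) (Delta X j)) \<le> 0" for j
    by (rule order_trans[OF opnorm_le_sum]) (auto simp: hadamard_def Delta_def intro!: sum_nonpos)
  then have "opnorm (hadamard (0\<^sub>m (length X) (length X)) (Delta X j)) \<le> 1" for j
    by (rule order_trans) simp
  moreover have "hermitian (0\<^sub>m (length X) (length X))"
    by (rule hermitianI[of _ "length X"]) auto
  ultimately show ?thesis by (simp add: adv_feasible_def)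
qed

lemma Adv_le:
  assumes "\<And>G. adv_feasible n X G \<Longrightarrow> opnorm (hadamard G (R - S)) \<le> c"
  shows "Adv n X R S \<le> c"
  unfolding Adv_altdef using adv_feasible_zero assms by (intro cSup_least) auto

lemma gram_unit_index:
  assumes "gram_unit m R" "k < m" "l < m"
  shows "cmod (R $$ (k,l)) \<le> 1" "R $$ (k,k) = 1"
proof -
  from assms(1) obtain d vs where vs: "\<forall>k<m. vs k \<in> unit_vecs d" "R = mat m m (\<lambda>(k,l). cinner (vs k) (vs l))"
    unfolding gram_unit_def by blast
  have u: "dim_vec (vs k) = d" "cnorm (vs k) = 1" if "k < m" for k
    using vs(1) that by (auto simp: unit_vecs_def)
  show "cmod (R $$ (k,l)) \<le> 1"
    using cmod_cinner_le[of "vs k" "vs l"] u assms by (simp add: vs(2))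
  show "R $$ (k,k) = 1" using u assms by (simp add: vs(2) cinner_self)
qed

lemma gram_unit_carrier: "gram_unit m R \<Longrightarrow> R \<in> carrier_mat m m"
  by (auto simp: gram_unit_def)

text \<open>The zero matrix contributes 0, but this bounds the real supremum from below only once
  the set is known to be bounded above. For distinct inputs some query index \<open>j\<close>
  separates them, so the entry of \<open>G\<close> is at most the norm of
  \<open>hadamard G (Delta X j)\<close>, hence at most 1, and the entries of \<open>R - S\<close>
  are at most 2.\<close>

lemma Adv_nonneg:
  fixes X :: "'a list list"
  assumes X: "distinct X" "\<forall>x \<in> set X. length x = n"
    and R: "gram_unit (length X) R" and S: "gram_unit (length X) S"
  shows "0 \<le> Adv n X R S"
proof -
  let ?m = "length X"
  have Rc: "R \<in> carrier_mat ?m ?m" "S \<in> carrier_mat ?m ?m" using R S by (auto dest: gram_unit_carrier)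
  have bd: "opnorm (hadamard G (R - S)) \<le> (\<Sum>x<?m. \<Sum>y<?m. 2)" if "adv_feasible n X G" for G
  proof -
    have G: "G \<in> carrier_mat ?m ?m" and Gj: "\<And>j. j < n \<Longrightarrow> opnorm (hadamard G (Delta X j)) \<le> 1"
      using that by (auto simp: adv_feasible_def)
    have entry: "cmod (hadamard G (R - S) $$ (x,y)) \<le> 2" if xy: "x < ?m" "y < ?m" for x y
    proof (cases "x = y")
      \<comment> \<open>The constraints say nothing about the diagonal of \<open>G\<close>, but
        \<open>R - S\<close> vanishes there because all vectors are unit vectors.\<close>
      case True
      then show ?thesis
        using xy G Rc gram_unit_index(2)[OF R xy] gram_unit_index(2)[OF S xy] by (simp add: hadamard_def)
    next
      case False
      then have "X ! x \<noteq> X ! y" using X(1) xy by (simp add: nth_eq_iff_index_eq)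
      moreover have "length (X ! x) = n" "length (X ! y) = n" using X(2) xy by auto
      ultimately obtain j where j: "j < n" "X ! x ! j \<noteq> X ! y ! j"
        by (metis nth_equalityI)
      have "G $$ (x,y) = hadamard G (Delta X j) $$ (x,y)"
        using xy G j by (simp add: hadamard_def Delta_def)
      also have "cmod \<dots> \<le> opnorm (hadamard G (Delta X j))"
        using xy G by (intro cmod_entry_le_opnorm[of _ ?m ?m]) (auto simp: hadamard_def)
      also have "\<dots> \<le> 1" by (rule Gj[OF j(1)])
      finally have G1: "cmod (G $$ (x,y)) \<le> 1" .
      have "cmod ((R - S) $$ (x,y)) \<le> 1 + 1"
        using xy Rc order_trans[OF norm_triangle_ineq4 add_mono[OF gram_unit_index(1)[OF R xy] gram_unit_index(1)[OF S xy]]]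
        by simp
      then have "cmod (G $$ (x,y)) * cmod ((R - S) $$ (x,y)) \<le> 1 * 2"
        using G1 by (intro mult_mono) auto
      then show ?thesis using xy G Rc by (simp add: hadamard_def norm_mult)
    qed
    have "opnorm (hadamard G (R - S)) \<le> (\<Sum>x<?m. \<Sum>y<?m. cmod (hadamard G (R - S) $$ (x,y)))"
      using opnorm_le_sum[of "hadamard G (R - S)"] G by (simp add: hadamard_def)
    also have "\<dots> \<le> (\<Sum>x<?m. \<Sum>y<?m. 2)" using entry by (intro sum_mono) auto
    finally show ?thesis .
  qed
  have "bdd_above {opnorm (hadamard G (R - S)) | G. adv_feasible n X G}"
    using bd by (auto intro!: bdd_aboveI)
  then have "opnorm (hadamard (0\<^sub>m ?m ?m) (R - S)) \<le> Adv n X R S"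
    unfolding Adv_altdef using adv_feasible_zero by (intro cSup_upper) auto
  then show ?thesis using opnorm_nonneg order_trans by blast
qed

text \<open>The common core of both claims: \<open>b k\<close> is the target state and
  \<open>c k\<close> the state that the algorithm actually reaches on input \<open>k\<close>. How
  the overlap is exploited is left to the two cases.\<close>

lemma converts_adversary_bound:
  fixes Sig :: "'a set" and X :: "'a list list"
  assumes X: "\<forall>x \<in> set X. length x = n \<and> set x \<subseteq> Sig"
    and h: "\<forall>y \<in> Sig. h y \<in> carrier_mat r r \<and> hermitian (h y) \<and> opnorm (h y) \<le> 1"
    and conv: "converts n r h X R S eps T"
  obtains b c N where "\<forall>k<length X. b k \<in> unit_vecs N" "\<forall>k<length X. c k \<in> unit_vecs N"
    "S = mat (length X) (length X) (\<lambda>(k,l). cinner (b k) (b l))"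
    "\<forall>k<length X. sqrt (1 - eps) \<le> Re (cinner (b k) (c k))"
    "Adv n X R (mat (length X) (length X) (\<lambda>(k,l). cinner (c k) (c l))) \<le> 2 * T"
proof -
  define m where "m = length X"
  from conv obtain w d HD \<alpha> a b U where T: "0 \<le> T"
    and HD: "\<forall>t\<in>{0..T}. HD t \<in> carrier_mat (n*r*w + d) (n*r*w + d) \<and> hermitian (HD t)"
    and pc: "\<forall>i < n*r*w + d. \<forall>j < n*r*w + d. piecewise_cont 0 T (\<lambda>t. HD t $$ (i,j))"
    and \<alpha>: "\<forall>t \<in> {0..T}. \<bar>\<alpha> t\<bar> \<le> 1"
    and ab: "\<forall>k < m. a k \<in> unit_vecs (n*r*w + d) \<and> b k \<in> unit_vecs (n*r*w + d)"
    and R: "R = mat m m (\<lambda>(k,l). cinner (a k) (a l))"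
    and S: "S = mat m m (\<lambda>(k,l). cinner (b k) (b l))"
    and gen: "\<forall>k < m. generated (\<lambda>t. HD t + complex_of_real (\<alpha> t) \<cdot>\<^sub>m HQ_tilde n r w d h (X ! k)) T (n*r*w + d) (U k) \<and>
         sqrt (1 - eps) \<le> Re (cinner (b k) (U k T *\<^sub>v a k))"
    unfolding converts_def m_def by auto
  define N where "N = n*r*w + d"
  define H where "H k t = HD t + complex_of_real (\<alpha> t) \<cdot>\<^sub>m HQ_tilde n r w d h (X ! k)" for k t
  define \<psi> where "\<psi> k t = U k t *\<^sub>v a k" for k t
  have hX: "h (X ! x ! j) \<in> carrier_mat r r \<and> hermitian (h (X ! x ! j)) \<and> opnorm (h (X ! x ! j)) \<le> 1"
    if "x < m" "j < n" for x j
  proof -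
    have "X ! x \<in> set X" using that by (simp add: m_def)
    then have "X ! x ! j \<in> Sig" using X that by (auto simp: subset_iff)
    then show ?thesis using h by blast
  qed
  have HD': "HD t \<in> carrier_mat N N" "hermitian (HD t)" if "0 \<le> t" "t \<le> T" for t
    using HD that by (auto simp: N_def)
  have H: "H k t \<in> carrier_mat N N" if "0 \<le> t" "t \<le> T" for k t
    unfolding H_def using HD'[OF that] by (auto simp: N_def)
  have hH: "hermitian (H k t)" if k: "k < m" and t: "0 \<le> t" "t \<le> T" for k t
  proof (rule hermitianI[OF H[OF t]])
    fix p q assume pq: "p < N" "q < N"
    have hQ: "hermitian (HQ_tilde n r w d h (X ! k))" using hX[OF k] by (intro hermitian_HQ_tilde) auto
    show "H k t $$ (p,q) = cnj (H k t $$ (q,p))"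
      using hermitian_index[OF HD'(2,1)[OF t] pq] hermitian_index[OF hQ HQ_tilde_carrier pq[unfolded N_def]] pq HD'(1)[OF t]
      unfolding H_def by (simp add: N_def)
  qed
  have a: "a k \<in> carrier_vec N" "cnorm (a k) = 1" if "k < m" for k
    using ab that by (auto simp: unit_vecs_def N_def intro: carrier_vecI)
  have genH: "generated (H k) T N (U k)" if "k < m" for k
    using gen that by (simp add: H_def[abs_def] N_def)
  have \<psi>0: "\<psi> k 0 = a k" if "k < m" for k
    unfolding \<psi>_def by (rule generated_state(1)[OF genH[OF that] T H a(1)[OF that]])
  have \<psi>int: "((\<lambda>s. - \<i> * (H k s *\<^sub>v \<psi> k s) $ p) has_integral \<psi> k t $ p - \<psi> k 0 $ p) {0..t}"
    if "k < m" "p < N" "0 \<le> t" "t \<le> T" for k p t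
    unfolding \<psi>_def using that(2-4) by (intro generated_state(2)[OF genH[OF that(1)] T H a(1)[OF that(1)]]) auto
  have \<psi>d: "dim_vec (\<psi> k t) = N" if "k < m" "0 \<le> t" "t \<le> T" for k t
    using genH[OF that(1)] that by (auto simp: generated_def \<psi>_def)
  \<comment> \<open>Each entry of the driver is bounded off its own finite set; uniting these
    finitely many sets gives one exceptional set and one bound for all entries and inputs.\<close>
  have "\<exists>Z Bh. finite Z \<and> (\<forall>k<m. \<forall>t. 0 \<le> t \<longrightarrow> t \<le> T \<longrightarrow> t \<notin> Z \<longrightarrow> (\<forall>p<N. \<forall>q<N. cmod (H k t $$ (p,q)) \<le> Bh))"
  proof -
    have "\<exists>Z. finite Z \<and> (\<exists>B. \<forall>t\<in>{0..T} - Z. cmod (HD t $$ i) \<le> B)"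
      if "i \<in> {..<N} \<times> {..<N}" for i
    proof -
      have "piecewise_cont 0 T (\<lambda>t. HD t $$ i)" using pc that by (auto simp: N_def)
      from piecewise_cont_bounded[OF this] show ?thesis by blast
    qed
    then have "\<forall>i\<in>{..<N} \<times> {..<N}. \<exists>Z. finite Z \<and> (\<exists>B. \<forall>t\<in>{0..T} - Z. cmod (HD t $$ i) \<le> B)"
      by blast
    from bchoice[OF this] obtain Z where "\<forall>i\<in>{..<N} \<times> {..<N}.
        finite (Z i) \<and> (\<exists>B. \<forall>t\<in>{0..T} - Z i. cmod (HD t $$ i) \<le> B)" ..
    note Z = bspec[OF this]
    define Z' where "Z' = (\<Union>i\<in>{..<N} \<times> {..<N}. Z i)"
    have "\<exists>B\<ge>0. \<forall>i\<in>{..<N} \<times> {..<N}. \<forall>t\<in>{0..T} - Z'. cmod (HD t $$ i) \<le> B"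
    proof (rule finite_uniform_bound)
      fix i assume i: "i \<in> {..<N} \<times> {..<N}"
      then have "Z i \<subseteq> Z'" by (auto simp: Z'_def)
      then show "\<exists>B. \<forall>t\<in>{0..T} - Z'. cmod (HD t $$ i) \<le> B" using Z[OF i] by blast
    qed simp
    then obtain B1 where B1: "\<forall>i\<in>{..<N} \<times> {..<N}. \<forall>t\<in>{0..T} - Z'. cmod (HD t $$ i) \<le> B1" by blast
    have "\<exists>B\<ge>0. \<forall>i\<in>{..<m} \<times> {..<N} \<times> {..<N}. \<forall>t\<in>{()}. cmod (HQ_tilde n r w d h (X ! fst i) $$ (snd i)) \<le> B"
      by (rule finite_uniform_bound) auto
    then obtain B2 where B2: "\<forall>i\<in>{..<m} \<times> {..<N} \<times> {..<N}. cmod (HQ_tilde n r w d h (X ! fst i) $$ (snd i)) \<le> B2"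
      by auto
    have "cmod (H k t $$ (p,q)) \<le> B1 + B2"
      if "k < m" "0 \<le> t" "t \<le> T" "t \<notin> Z'" "p < N" "q < N" for k t p q
    proof -
      let ?q = "HQ_tilde n r w d h (X ! k) $$ (p,q)"
      have "H k t $$ (p,q) = HD t $$ (p,q) + of_real (\<alpha> t) * ?q"
        unfolding H_def using that HD'(1)[OF that(2,3)] by (simp add: N_def)
      also have "cmod \<dots> \<le> cmod (HD t $$ (p,q)) + \<bar>\<alpha> t\<bar> * cmod ?q"
        using norm_triangle_ineq[of "HD t $$ (p,q)" "of_real (\<alpha> t) * ?q"] by (simp add: norm_mult)
      also have "\<dots> \<le> B1 + 1 * cmod ?q"
        using B1 \<alpha> that by (intro add_mono mult_right_mono) auto
      also have "\<dots> \<le> B1 + B2" using B2[rule_format, of "(k,p,q)"] that by simp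
      finally show ?thesis .
    qed
    moreover have "finite Z'" using Z by (auto simp: Z'_def)
    ultimately show ?thesis by (intro exI[of _ Z'] exI[of _ "B1 + B2"]) auto
  qed
  then obtain Z Bh where Z: "finite Z" and "\<forall>k<m. \<forall>t. 0 \<le> t \<longrightarrow> t \<le> T \<longrightarrow> t \<notin> Z \<longrightarrow>
    (\<forall>p<N. \<forall>q<N. cmod (H k t $$ (p,q)) \<le> Bh)" by (elim exE conjE)
  note Hb = this(2)[rule_format]
  \<comment> \<open>Norm conservation is applied on \<open>{0..t}\<close> for every
    \<open>t\<close>, since the derivative bound needs unit states at all intermediate
    times.\<close>
  have \<psi>n: "cnorm (\<psi> k t) = 1" if k: "k < m" and t: "0 \<le> t" "t \<le> T" for k t
  proof -
    have "cnorm (\<psi> k t) = cnorm (\<psi> k 0)"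
    proof (rule cnorm_evolution[OF t(1) Z, where H = "H k" and N = N and Bh = Bh])
      show "((\<lambda>s. - \<i> * (H k s *\<^sub>v \<psi> k s) $ p) has_integral \<psi> k t' $ p - \<psi> k 0 $ p) {0..t'}"
        if "p < N" "0 \<le> t'" "t' \<le> t" for p t'
        using that t by (intro \<psi>int[OF k]) auto
    qed (use \<psi>d[OF k] H hH[OF k] Hb[OF k] t in auto)
    then show ?thesis using \<psi>0[OF k] a(2)[OF k] by simp
  qed
  define S' where "S' = mat m m (\<lambda>(k,l). cinner (\<psi> k T) (\<psi> l T))"
  have "Adv n X R S' \<le> 2 * T"
  proof (rule Adv_le)
    fix G assume "adv_feasible n X G"
    then have G: "G \<in> carrier_mat m m" and Gj: "\<And>j. j < n \<Longrightarrow> opnorm (hadamard G (Delta X j)) \<le> 1"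
      by (auto simp: adv_feasible_def m_def)
    have c: "hadamard G (R - S') \<in> carrier_mat m m" using G by (auto simp: hadamard_def)
    show "opnorm (hadamard G (R - S')) \<le> 2 * T"
    proof (rule opnorm_leI[OF c])
      fix u v :: cvec assume u: "dim_vec u = m" and v: "dim_vec v = m"
      have "cmod (\<Sum>x<m. \<Sum>y<m. (cnj (u $ x) * v $ y * G $$ (x,y)) *
          (cinner (\<psi> x T) (\<psi> y T) - cinner (\<psi> x 0) (\<psi> y 0))) \<le> (2 * (cnorm u * cnorm v)) * T"
      proof (rule evolution_gram_increment[OF T Z \<psi>d H Hb \<psi>int])
        fix t assume t: "0 \<le> t" "t \<le> T"
        have \<alpha>t: "\<bar>\<alpha> t\<bar> \<le> 1" using \<alpha> t by simp
        show "cmod (\<Sum>x<m. \<Sum>y<m. (cnj (u $ x) * v $ y * G $$ (x,y)) *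
          (\<i> * (cinner (H x t *\<^sub>v \<psi> x t) (\<psi> y t) - cinner (\<psi> x t) (H y t *\<^sub>v \<psi> y t)))) \<le> 2 * (cnorm u * cnorm v)"
          unfolding m_def
          by (rule adversary_derivative_bound[where n = n and r = r and w = w and d = d and h = h and HD = "HD t" and \<alpha> = "\<alpha> t"])
             (use hX G Gj \<psi>d \<psi>n t HD' \<alpha>t u v in \<open>auto simp: m_def N_def H_def\<close>)
      qed auto
      \<comment> \<open>The minus sign arises because the increment is the final minus the initial
        Gram matrix, whereas \<open>R - S'\<close> is the initial minus the final one.\<close>
      also have "(\<Sum>x<m. \<Sum>y<m. (cnj (u $ x) * v $ y * G $$ (x,y)) *
          (cinner (\<psi> x T) (\<psi> y T) - cinner (\<psi> x 0) (\<psi> y 0))) = - cinner u (hadamard G (R - S') *\<^sub>v v)"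
      proof -
        have "cinner u (hadamard G (R - S') *\<^sub>v v) = (\<Sum>x<m. \<Sum>y<m. cnj (u $ x) * (hadamard G (R - S') $$ (x,y) * v $ y))"
          unfolding cinner_def u sum_distrib_left[symmetric] using c v
          by (intro sum.cong refl arg_cong2[where f = "(*)"], subst mult_mat_vec_index_sum) auto
        then show ?thesis unfolding sum_negf[symmetric]
          using G \<psi>0 by (auto simp: hadamard_def R S'_def algebra_simps sum_negf[symmetric] intro!: sum.cong)
      qed
      finally show "cmod (cinner u (hadamard G (R - S') *\<^sub>v v)) \<le> 2 * T * (cnorm u * cnorm v)"
        by (simp add: mult_ac)
    qed (use T in simp)
  qed
  moreover have "\<forall>k<m. \<psi> k T \<in> unit_vecs N"
    using \<psi>n \<psi>d T by (auto simp: unit_vecs_def)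
  moreover have "\<forall>k<m. sqrt (1 - eps) \<le> Re (cinner (b k) (\<psi> k T))"
    using gen by (simp add: \<psi>_def)
  moreover have "\<forall>k<m. b k \<in> unit_vecs N" using ab by (simp add: N_def)
  ultimately show thesis using that[of b N "\<lambda>k. \<psi> k T"] S unfolding m_def S'_def by blast
qed

text \<open>The squared distance of two unit vectors is 2 minus twice the real part of their inner
  product.\<close>

lemma unit_vecs_eqI:
  assumes "b \<in> unit_vecs N" "c \<in> unit_vecs N" "1 \<le> Re (cinner b c)"
  shows "b = c"
proof -
  have d: "dim_vec b = N" "dim_vec c = N" and n: "cinner b b = 1" "cinner c c = 1"
    using assms by (auto simp: unit_vecs_def cinner_self)
  have "cinner (b - c) (b - c) = cinner b b - cinner b c - cinner c b + cinner c c"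
    unfolding cinner_def using d by (simp add: algebra_simps sum_subtractf sum.distrib)
  also have "cinner c b = cnj (cinner b c)" using d by (intro cinner_commute) simp
  finally have "Re (cinner (b - c) (b - c)) = 2 - 2 * Re (cinner b c)" by (simp add: n)
  then have "(cnorm (b - c))\<^sup>2 \<le> 0" using assms(3) by (simp add: cinner_self)
  then have z: "b - c = 0\<^sub>v N" using d by (simp add: cnorm_eq_0_iff)
  show ?thesis
  proof (rule eq_vecI)
    fix i assume "i < dim_vec c"
    moreover then have "(b - c) $ i = 0" using z d by simp
    ultimately show "b $ i = c $ i" using d by simp
  qed (use d in simp)
qed

theorem theorem3p1:
  fixes Sig :: "'a set" and n r :: nat and h :: "'a \<Rightarrow> complex mat"
    and X :: "'a list list" and R S :: "complex mat" and eps :: real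
  assumes "finite Sig" and "n \<ge> 1"
    and "distinct X" and "\<forall>x \<in> set X. length x = n \<and> set x \<subseteq> Sig"
    and "gram_unit (length X) R" and "gram_unit (length X) S"
    and "\<forall>y \<in> Sig. h y \<in> carrier_mat r r \<and> hermitian (h y) \<and> opnorm (h y) \<le> 1"
    and "0 \<le> eps" and "eps < 1"
  shows "ereal (Adv n X R S / 2) \<le> Q_ct n r h X R S 0
    \<and> ereal (Inf {Adv n X R S' | S'. gram_unit (length X) S' \<and> ereal (sqrt (1 - eps)) \<le> fid_H S S'} / 2)
        \<le> Q_ct n r h X R S eps"
proof
  show "ereal (Adv n X R S / 2) \<le> Q_ct n r h X R S 0"
    unfolding Q_ct_def
  proof (rule INF_greatest)
    fix T assume "T \<in> {T. converts n r h X R S 0 T}"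
    then have "converts n r h X R S 0 T" by simp
    then obtain b c N where b: "\<forall>k<length X. b k \<in> unit_vecs N" and c: "\<forall>k<length X. c k \<in> unit_vecs N"
      and S: "S = mat (length X) (length X) (\<lambda>(k,l). cinner (b k) (b l))"
      and ov: "\<forall>k<length X. sqrt (1 - 0) \<le> Re (cinner (b k) (c k))"
      and le: "Adv n X R (mat (length X) (length X) (\<lambda>(k,l). cinner (c k) (c l))) \<le> 2 * T"
      by (rule converts_adversary_bound[OF assms(4,7)])
    \<comment> \<open>Zero error forces overlap at least 1, so the algorithm reaches the target
      vectors themselves and the final Gram matrix is \<open>S\<close>.\<close>
    have "b k = c k" if "k < length X" for k
      using b c ov that by (intro unit_vecs_eqI[of _ N]) auto
    then have "mat (length X) (length X) (\<lambda>(k,l). cinner (c k) (c l)) = S"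
      unfolding S by (intro eq_matI) auto
    then show "ereal (Adv n X R S / 2) \<le> ereal T" using le by simp
  qed
  show "ereal (Inf {Adv n X R S' | S'. gram_unit (length X) S' \<and> ereal (sqrt (1 - eps)) \<le> fid_H S S'} / 2)
        \<le> Q_ct n r h X R S eps"
    unfolding Q_ct_def
  proof (rule INF_greatest)
    fix T assume "T \<in> {T. converts n r h X R S eps T}"
    then have "converts n r h X R S eps T" by simp
    then obtain b c N where b: "\<forall>k<length X. b k \<in> unit_vecs N" and c: "\<forall>k<length X. c k \<in> unit_vecs N"
      and S: "S = mat (length X) (length X) (\<lambda>(k,l). cinner (b k) (b l))"
      and ov: "\<forall>k<length X. sqrt (1 - eps) \<le> Re (cinner (b k) (c k))"
      and le: "Adv n X R (mat (length X) (length X) (\<lambda>(k,l). cinner (c k) (c l))) \<le> 2 * T"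
      by (rule converts_adversary_bound[OF assms(4,7)])
    define S' where "S' = mat (length X) (length X) (\<lambda>(k,l). cinner (c k) (c l))"
    have "gram_unit (length X) S'" unfolding gram_unit_def S'_def using c by blast
    moreover have "ereal (sqrt (1 - eps)) \<le> fid_H S S'"
      unfolding S S'_def using b c ov by (intro fid_H_ge) auto
    \<comment> \<open>The infimum is taken over reals, so it lies below the value at the feasible
      \<open>S'\<close> only because the set is bounded below; \<open>Adv_nonneg\<close> provides
      the bound 0.\<close>
    ultimately have "Inf {Adv n X R S' | S'. gram_unit (length X) S' \<and> ereal (sqrt (1 - eps)) \<le> fid_H S S'} \<le> Adv n X R S'"
      using Adv_nonneg[OF assms(3) _ assms(5)] assms(4)
      by (intro cInf_lower bdd_belowI[of _ 0]) auto
    then show "ereal (Inf {Adv n X R S' | S'. gram_unit (length X) S' \<and> ereal (sqrt (1 - eps)) \<le> fid_H S S'} / 2) \<le> ereal T"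
      using le by (simp add: S'_def)
  qed
qed

end
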